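(* Let $G=(V,w,m)$ be a finite measured weighted graph which is spectrally positive, i.e. there exist $K>0$, $n\in(0,\infty]$ and $\rho\colon V\to\mathbb{R}$ such that $G$ satisfies the variable curvature dimension condition $CD(\rho,n)$ and $$\tfrac12\langle Lf,f\rangle+\langle\rho f,f\rangle\ge K\langle f,f\rangle\quad\text{for all } f\colon V\to\mathbb{R}.$$ Then the fundamental group of $G$ is finite, i.e. the universal cover of the CW-complex $X_G$ (the graph $G$ with all cycles of length $3$ and $4$ filled with disks) is finite.
   Context: A measured weighted graph (mwg) $G=(V,w,m)$ consists of a countable set $V$, a symmetric function $w\colon V\times V\to[0,\infty)$ vanishing on the diagonal, and a function $m\colon V\to(0,\infty)$. All mwg are assumed locally finite (for each $x\in V$ the set $\{y: w(x,y)>0\}$ is finite) and connected. It is finite if $V$ is finite. Vertices $x,y$ are joined by an edge iff $w(x,y)>0$. Write $q(x,y)=w(x,y)/m(x)$. $L^2(V)$ carries the inner product $\langle f,g\rangle=\sum_{x}m(x)f(x)g(x)$. For $f\colon V\to\mathbb{R}$ the Laplacian is $\Delta f(x)=\sum_{y}q(x,y)(f(y)-f(x))$, and $L=-\Delta\ge 0$. For bounded $f,g\colon V\to\mathbb{R}$: $\Gamma(f,g)=\frac12(\Delta(fg)-f\Delta g-g\Delta f)$ and $\Gamma_2(f,g)=\frac12(\Delta\Gamma(f,g)-\Gamma(f,\Delta g)-\Gamma(g,\Delta f))$; $\Gamma f:=\Gamma(f,f)$, $\Gamma_2f:=\Gamma_2(f,f)$. $G$ satisfies $CD(\rho,n)$,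 for $\rho\colon V\to\mathbb{R}$ and $n\in(0,\infty]$, if for all bounded $f\colon V\to\mathbb{R}$ and all $x\in V$: $\Gamma_2f(x)\ge\rho(x)\Gamma f(x)+\frac1n(\Delta f(x))^2$ (with $\frac1\infty=0$). The CW-complex $X_G$ is the 2-dimensional CW-complex whose $1$-skeleton is the graph $G$ and in which all cycles of length $3$ and $4$ are filled with disks ($2$-cells). The fundamental group of $G$ means the fundamental group of $X_G$. *)

theory Defs
  imports "HOL-Analysis.Analysis" "HOL-Algebra.Group"
begin

section \<open>Measured weighted graphs\<close>

text \<open>The vertex set is the whole type.\<close>

definition adjacent :: "('v \<Rightarrow> 'v \<Rightarrow> real) \<Rightarrow> 'v \<Rightarrow> 'v \<Rightarrow> bool" where
  "adjacent w x y \<longleftrightarrow> w x y > 0"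

locale mwg =
  fixes w :: "'v \<Rightarrow> 'v \<Rightarrow> real" and m :: "'v \<Rightarrow> real"
  assumes countable_vertices: "countable (UNIV :: 'v set)"
    and weight_nonneg: "0 \<le> w x y"
    and weight_sym: "w x y = w y x"
    and weight_diag: "w x x = 0"
    and measure_pos: "0 < m x"
    and locally_finite: "finite {y. adjacent w x y}"
    and connected_graph: "(adjacent w)\<^sup>*\<^sup>* x y"

definition inner_m :: "('v \<Rightarrow> real) \<Rightarrow> ('v \<Rightarrow> real) \<Rightarrow> ('v \<Rightarrow> real) \<Rightarrow> real" where
  "inner_m m f g = (\<Sum>\<^sub>\<infinity>x. m x * f x * g x)"

definition laplacian ::
  "('v \<Rightarrow> 'v \<Rightarrow> real) \<Rightarrow> ('v \<Rightarrow> real) \<Rightarrow> ('v \<Rightarrow> real) \<Rightarrow> 'v \<Rightarrow> real" where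
  "laplacian w m f x = (\<Sum>y | adjacent w x y. w x y / m x * (f y - f x))"

definition carre_du_champ ::
  "('v \<Rightarrow> 'v \<Rightarrow> real) \<Rightarrow> ('v \<Rightarrow> real) \<Rightarrow> ('v \<Rightarrow> real) \<Rightarrow> ('v \<Rightarrow> real) \<Rightarrow> 'v \<Rightarrow> real" where
  "carre_du_champ w m f g x =
     1/2 * (laplacian w m (\<lambda>z. f z * g z) x - f x * laplacian w m g x - g x * laplacian w m f x)"

definition carre_du_champ2 ::
  "('v \<Rightarrow> 'v \<Rightarrow> real) \<Rightarrow> ('v \<Rightarrow> real) \<Rightarrow> ('v \<Rightarrow> real) \<Rightarrow> ('v \<Rightarrow> real) \<Rightarrow> 'v \<Rightarrow> real" where
  "carre_du_champ2 w m f g x =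
     1/2 * (laplacian w m (carre_du_champ w m f g) x
            - carre_du_champ w m f (laplacian w m g) x
            - carre_du_champ w m g (laplacian w m f) x)"

text \<open>The value \<open>n = \<infinity>\<close> is allowed; then \<open>1 / n = 0\<close>.\<close>

definition curvature_dimension ::
  "('v \<Rightarrow> 'v \<Rightarrow> real) \<Rightarrow> ('v \<Rightarrow> real) \<Rightarrow> ('v \<Rightarrow> real) \<Rightarrow> ereal \<Rightarrow> bool" where
  "curvature_dimension w m \<rho> n \<longleftrightarrow>
     (\<forall>f. bounded (range f) \<longrightarrow>
        (\<forall>x. carre_du_champ2 w m f f x
              \<ge> \<rho> x * carre_du_champ w m f f x + real_of_ereal (1 / n) * (laplacian w m f x)\<^sup>2))"

definition spectrally_positive :: "('v \<Rightarrow> 'v \<Rightarrow> real) \<Rightarrow> ('v \<Rightarrow> real) \<Rightarrow> bool" where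
  "spectrally_positive w m \<longleftrightarrow>
     (\<exists>(K::real) (n::ereal) \<rho>. K > 0 \<and> n > 0 \<and> curvature_dimension w m \<rho> n \<and>
        (\<forall>f. 1/2 * inner_m m (\<lambda>x. - laplacian w m f x) f + inner_m m (\<lambda>x. \<rho> x * f x) f
              \<ge> K * inner_m m f f))"

section \<open>The 2-complex of a graph\<close>

definition graph_edges :: "('v \<Rightarrow> 'v \<Rightarrow> real) \<Rightarrow> 'v set set" where
  "graph_edges w = {{x, y} | x y. adjacent w x y}"

definition graph_cycle :: "('v \<Rightarrow> 'v \<Rightarrow> real) \<Rightarrow> 'v list \<Rightarrow> bool" where
  "graph_cycle w vs \<longleftrightarrow> 3 \<le> length vs \<and> distinct vs \<and>
     (\<forall>i < length vs. adjacent w (vs ! i) (vs ! (Suc i mod length vs)))"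

definition cycle_edges :: "'v list \<Rightarrow> 'v set set" where
  "cycle_edges vs = {{vs ! i, vs ! (Suc i mod length vs)} | i. i < length vs}"

text \<open>Cycles are represented by their edge sets, so that the rotations and the reversal of a
  cyclic vertex list all give the same cycle and only one disk is attached to it.\<close>

definition short_cycles :: "('v \<Rightarrow> 'v \<Rightarrow> real) \<Rightarrow> 'v set set set" where
  "short_cycles w = {cycle_edges vs | vs. graph_cycle w vs \<and> length vs \<in> {3, 4}}"

text \<open>For a finite graph the complex is realised in the Euclidean space that has one coordinate
  axis for each vertex and one for each potential cycle. A vertex is the unit vector of its axis,
  an edge is the segment between its end points, and the disk filling a cycle \<open>C\<close> is the cone over
  the polygon \<open>C\<close> whose apex is the unit vector of the axis of \<open>C\<close>. The polygons are embedded
  circles and the apexes are affinely independent of everything else, so each such cone is a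
  closed disk meeting the rest of the complex exactly in \<open>C\<close>. As there are finitely many cells,
  the subspace topology is the CW topology.\<close>

type_synonym 'v complex_space = "real ^ ('v + 'v set set)"

definition vertex_point :: "'v \<Rightarrow> ('v::finite) complex_space" where
  "vertex_point v = axis (Inl v) 1"

definition apex_point :: "'v set set \<Rightarrow> ('v::finite) complex_space" where
  "apex_point C = axis (Inr C) 1"

definition edge_segment :: "'v set \<Rightarrow> ('v::finite) complex_space set" where
  "edge_segment e = convex hull (vertex_point ` e)"

definition polygon :: "'v set set \<Rightarrow> ('v::finite) complex_space set" where
  "polygon C = (\<Union>e\<in>C. edge_segment e)"

definition filled_polygon :: "'v set set \<Rightarrow> ('v::finite) complex_space set" where
  "filled_polygon C = (\<Union>e\<in>C. convex hull (insert (apex_point C) (vertex_point ` e)))"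

definition open_cells :: "('v::finite \<Rightarrow> 'v \<Rightarrow> real) \<Rightarrow> 'v complex_space set set" where
  "open_cells w =
     range (\<lambda>v. {vertex_point v})
     \<union> (\<lambda>e. edge_segment e - vertex_point ` e) ` graph_edges w
     \<union> (\<lambda>C. filled_polygon C - polygon C) ` short_cycles w"

definition graph_complex :: "('v::finite \<Rightarrow> 'v \<Rightarrow> real) \<Rightarrow> 'v complex_space set" where
  "graph_complex w = \<Union>(open_cells w)"

section \<open>Fundamental group and universal cover\<close>

definition loops_at :: "'a::topological_space set \<Rightarrow> 'a \<Rightarrow> (real \<Rightarrow> 'a) set" where
  "loops_at S a = {p. path p \<and> path_image p \<subseteq> S \<and> pathstart p = a \<and> pathfinish p = a}"

definition path_class :: "'a::topological_space set \<Rightarrow> (real \<Rightarrow> 'a) \<Rightarrow> (real \<Rightarrow> 'a) set" where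
  "path_class S p = {q. homotopic_paths S p q}"

definition fundamental_group ::
  "'a::topological_space set \<Rightarrow> 'a \<Rightarrow> (real \<Rightarrow> 'a) set monoid" where
  "fundamental_group S a =
     \<lparr>carrier = path_class S ` loops_at S a,
      mult = (\<lambda>P Q. \<Union>p\<in>P. \<Union>q\<in>Q. path_class S (p +++ q)),
      one = path_class S (\<lambda>_. a)\<rparr>"

lemma path_class_eq_iff:
  assumes "p \<in> loops_at S a" "q \<in> loops_at S a"
  shows "path_class S p = path_class S q \<longleftrightarrow> homotopic_paths S p q"
proof
  assume "path_class S p = path_class S q"
  moreover have "q \<in> path_class S q"
    using assms by (auto simp: path_class_def loops_at_def)
  ultimately show "homotopic_paths S p q"
    by (auto simp: path_class_def)
next
  assume "homotopic_paths S p q"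
  then show "path_class S p = path_class S q"
    using homotopic_paths_trans[of S p q] homotopic_paths_trans[of S q p] homotopic_paths_sym[of S p q]
    unfolding path_class_def by blast
qed

lemma loops_at_homotopic:
  "p \<in> loops_at S a \<Longrightarrow> homotopic_paths S p q \<Longrightarrow> q \<in> loops_at S a"
  using homotopic_paths_imp_path[of S p q] homotopic_paths_imp_subset[of S p q]
    homotopic_paths_imp_pathstart[of S p q] homotopic_paths_imp_pathfinish[of S p q]
  by (simp add: loops_at_def)

lemma loops_at_join:
  "p \<in> loops_at S a \<Longrightarrow> q \<in> loops_at S a \<Longrightarrow> p +++ q \<in> loops_at S a"
  unfolding loops_at_def by (simp add: subset_path_image_join)

lemma fundamental_group_mult:
  assumes p: "p \<in> loops_at S a" and q: "q \<in> loops_at S a"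
  shows "path_class S p \<otimes>\<^bsub>fundamental_group S a\<^esub> path_class S q = path_class S (p +++ q)"
proof -
  have "path_class S (p' +++ q') = path_class S (p +++ q)"
    if "p' \<in> path_class S p" "q' \<in> path_class S q" for p' q'
  proof -
    have h: "homotopic_paths S p p'" "homotopic_paths S q q'"
      using that by (auto simp: path_class_def)
    have "homotopic_paths S (p +++ q) (p' +++ q')"
      using homotopic_paths_join[OF h] p q by (auto simp: loops_at_def)
    then show ?thesis
      using path_class_eq_iff[OF loops_at_join[OF p q] loops_at_join[OF loops_at_homotopic[OF p h(1)]
            loops_at_homotopic[OF q h(2)]]] by simp
  qed
  moreover have "p \<in> path_class S p" "q \<in> path_class S q"
    using p q by (auto simp: path_class_def loops_at_def)
  ultimately have "(\<Union>p'\<in>path_class S p. \<Union>q'\<in>path_class S q. path_class S (p' +++ q'))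
      = (\<Union>p'\<in>path_class S p. \<Union>q'\<in>path_class S q. path_class S (p +++ q))"
    by (intro SUP_cong refl)
  also have "\<dots> = path_class S (p +++ q)"
    using \<open>p \<in> path_class S p\<close> \<open>q \<in> path_class S q\<close>
    by (metis UN_constant empty_iff)
  finally show ?thesis
    unfolding fundamental_group_def by simp
qed

lemma group_fundamental_group:
  fixes S :: "'a::real_normed_vector set"
  assumes "a \<in> S"
  shows "group (fundamental_group S a)"
proof -
  have c: "(\<lambda>_. a) = linepath a a"
    by (auto simp: linepath_def algebra_simps)
  have one: "linepath a a \<in> loops_at S a"
    using assms by (auto simp: loops_at_def)
  have car: "carrier (fundamental_group S a) = path_class S ` loops_at S a"
    and o: "\<one>\<^bsub>fundamental_group S a\<^esub> = path_class S (linepath a a)"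
    by (simp_all add: fundamental_group_def c)
  show ?thesis
  proof (rule groupI)
    fix x y z
    assume "x \<in> carrier (fundamental_group S a)" "y \<in> carrier (fundamental_group S a)"
      "z \<in> carrier (fundamental_group S a)"
    then obtain p q r where *: "p \<in> loops_at S a" "q \<in> loops_at S a" "r \<in> loops_at S a"
      "x = path_class S p" "y = path_class S q" "z = path_class S r"
      by (auto simp: car)
    have "homotopic_paths S (p +++ (q +++ r)) ((p +++ q) +++ r)"
      using *(1-3) by (intro homotopic_paths_assoc) (auto simp: loops_at_def)
    then show "x \<otimes>\<^bsub>fundamental_group S a\<^esub> y \<otimes>\<^bsub>fundamental_group S a\<^esub> z =
        x \<otimes>\<^bsub>fundamental_group S a\<^esub> (y \<otimes>\<^bsub>fundamental_group S a\<^esub> z)"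
      using * by (simp add: fundamental_group_mult loops_at_join path_class_eq_iff[of _ S a]
          homotopic_paths_sym)
  next
    fix x assume "x \<in> carrier (fundamental_group S a)"
    then obtain p where *: "p \<in> loops_at S a" "x = path_class S p"
      by (auto simp: car)
    have "homotopic_paths S (linepath a a +++ p) p"
      using * by (intro homotopic_paths_lid') (auto simp: loops_at_def)
    then show "\<one>\<^bsub>fundamental_group S a\<^esub> \<otimes>\<^bsub>fundamental_group S a\<^esub> x = x"
      using * one by (simp add: o fundamental_group_mult loops_at_join path_class_eq_iff[of _ S a])
    have r: "reversepath p \<in> loops_at S a"
      using * by (auto simp: loops_at_def)
    have "homotopic_paths S (reversepath p +++ p) (linepath a a)"
      using * homotopic_paths_linv[of p S] by (auto simp: loops_at_def)
    then have "path_class S (reversepath p) \<otimes>\<^bsub>fundamental_group S a\<^esub> x = \<one>\<^bsub>fundamental_group S a\<^esub>"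
      using * one r by (simp add: o fundamental_group_mult loops_at_join path_class_eq_iff[of _ S a])
    then show "\<exists>y\<in>carrier (fundamental_group S a).
        y \<otimes>\<^bsub>fundamental_group S a\<^esub> x = \<one>\<^bsub>fundamental_group S a\<^esub>"
      using r by (auto simp: car)
  qed (use one in \<open>auto simp: car o fundamental_group_mult loops_at_join\<close>)
qed

definition universal_cover ::
  "'c::topological_space set \<Rightarrow> ('c \<Rightarrow> 'a) \<Rightarrow> 'a::topological_space set \<Rightarrow> bool" where
  "universal_cover U p S \<longleftrightarrow> covering_space U p S \<and> simply_connected U"

text \<open>The cells of a covering space of a CW-complex are the connected components of the preimages
  of the open cells of the base.\<close>

definition lifted_cells :: "'c::topological_space set \<Rightarrow> ('c \<Rightarrow> 'a) \<Rightarrow> 'a set set \<Rightarrow> 'c set set" where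
  "lifted_cells U p \<C> = (\<Union>e\<in>\<C>. components (U \<inter> p -` e))"

end

theory Submission
  imports Defs
begin

text \<open>Only finiteness of the set of homotopy classes of edge paths from a base vertex has to be
proved. Every loop in the complex is homotopic to an edge path (\<open>path_homotopic_edge_path\<close>), up to
a conjugation that moves the base point to a vertex, so this set bounds the fundamental group. The
fundamental group bounds the fibres of a simply connected covering space by monodromy
(\<open>finite_fibre\<close>), and every component of the preimage of an open cell meets the fibre of a fixed
point of the cell.

The homotopy classes of edge paths are the vertices of the universal covering graph. Triangles and
squares of the graph bound disks, so they lift to closed walks. Therefore the balls of radius 2, as
far as \<open>\<Gamma>\<^sub>2\<close> sees them, are the same in the cover and in the base, and the curvature condition lifts
(\<open>curvature_lift\<close>). The spectral condition concerns functions on the finite graph; what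
passes to the cover is a positive function \<open>\<phi>\<close> with \<open>(\<Delta> - 2 \<rho>) \<phi> = -2\<close>
(\<open>positive_supersolution\<close>), which exists by this condition and can be pulled back.

Bakry-Emery theory suggests that \<open>\<Gamma> (P\<^sub>t f)\<close> is dominated by the Schroedinger semigroup with
generator \<open>\<Delta> - 2 \<rho>\<close> applied to \<open>\<Gamma> f\<close>, hence decays exponentially relative to \<open>\<phi>\<close>. On a graph of
bounded degree the heat semigroup may be replaced by powers of \<open>1 + e \<Delta>\<close> for a small fixed \<open>e\<close>, so that
no analysis on the infinite graph is needed (\<open>gradient_contraction\<close>). Applied to the distance from
the base vertex, the decay of gradients shows that the distance is bounded, and the cover is finite
(\<open>finite_cover\<close>).\<close>

section \<open>A positive supersolution on the base graph\<close>

text \<open>Spectral positivity says that \<open>H = L/2 + \<rho>\<close> is positive definite, so \<open>H \<phi> = 1\<close> has a solution. It is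
positive by the maximum principle for \<open>H\<close>, in its quadratic form version: testing against the
negative part of \<open>\<phi>\<close> shows that this part vanishes. A positive function of this kind is the form of
spectral positivity that survives on an infinite cover: pulled back, it still has positive
lower and finite upper bounds and satisfies the same local equation.\<close>

lemma positive_supersolution:
  fixes w :: "'v::finite \<Rightarrow> 'v \<Rightarrow> real"
  assumes "mwg w m" and K: "K > 0"
    and spec: "\<And>f. 1/2 * inner_m m (\<lambda>x. - laplacian w m f x) f + inner_m m (\<lambda>x. \<rho> x * f x) f
              \<ge> K * inner_m m f f"
  obtains \<phi> where "\<And>x. \<phi> x > 0" "\<And>x. laplacian w m \<phi> x - 2 * \<rho> x * \<phi> x = -2"
proof -
  interpret mwg w m by fact
  define H where "H f x = - 1/2 * laplacian w m f x + \<rho> x * f x" for f x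
  have coercive: "(\<Sum>x\<in>UNIV. m x * H f x * f x) \<ge> K * (\<Sum>x\<in>UNIV. m x * (f x)\<^sup>2)" for f
  proof -
    have "(\<Sum>x\<in>UNIV. m x * H f x * f x)
        = 1/2 * inner_m m (\<lambda>x. - laplacian w m f x) f + inner_m m (\<lambda>x. \<rho> x * f x) f"
      unfolding inner_m_def H_def
      by (simp add: sum_distrib_left flip: sum.distrib) (simp add: algebra_simps)
    also have "\<dots> \<ge> K * inner_m m f f" by (rule spec)
    also have "inner_m m f f = (\<Sum>x\<in>UNIV. m x * (f x)\<^sup>2)"
      by (simp add: inner_m_def power2_eq_square mult.assoc)
    finally show ?thesis .
  qed
  have definite: "f x = 0" if "(\<Sum>x\<in>UNIV. m x * H f x * f x) \<le> 0" for f x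
  proof -
    have "K * (\<Sum>x\<in>UNIV. m x * (f x)\<^sup>2) \<le> 0"
      using coercive[of f] that by linarith
    then have "(\<Sum>x\<in>UNIV. m x * (f x)\<^sup>2) \<le> 0"
      using K by (simp add: mult_le_0_iff)
    moreover have nn: "\<And>x. m x * (f x)\<^sup>2 \<ge> 0"
      using measure_pos by (simp add: less_imp_le)
    ultimately have "(\<Sum>x\<in>UNIV. m x * (f x)\<^sup>2) = 0"
      by (meson antisym sum_nonneg)
    then have "m x * (f x)\<^sup>2 = 0"
      using nn by (simp add: sum_nonneg_eq_0_iff)
    then show ?thesis using measure_pos[of x] by simp
  qed
  have H_add: "H (\<lambda>z. f z + g z) x = H f x + H g x" for f g x
    by (simp add: H_def laplacian_def sum.distrib[symmetric] algebra_simps)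
       (simp add: sum.distrib sum_subtractf algebra_simps diff_divide_distrib add_divide_distrib)
  have H_scale: "H (\<lambda>z. c * f z) x = c * H f x" for f c x
  proof -
    have "laplacian w m (\<lambda>z. c * f z) x = c * laplacian w m f x"
      by (simp add: laplacian_def sum_distrib_left right_diff_distrib mult.left_commute)
    then show ?thesis by (simp add: H_def algebra_simps)
  qed
  let ?T = "\<lambda>v :: real^'v. \<chi> x. H (\<lambda>z. v $ z) x"
  have lin: "linear ?T"
    by (rule linearI) (simp_all add: vec_eq_iff H_add H_scale)
  have "v = 0" if "?T v = 0" for v
  proof -
    have "H (\<lambda>z. v $ z) x = 0" for x using that by (simp add: vec_eq_iff)
    then have "v $ x = 0" for x
      using definite[of "\<lambda>z. v $ z" x] by simp
    then show ?thesis by (simp add: vec_eq_iff)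
  qed
  then have "inj ?T" unfolding linear_injective_0[OF lin] by blast
  then have "surj ?T" by (rule linear_inj_imp_surj[OF lin])
  then have "(\<chi> x. 1) \<in> range ?T" by (simp only: UNIV_I)
  then obtain v where v: "(\<chi> x. 1) = ?T v" by (rule rangeE)
  define \<phi> where "\<phi> x = v $ x" for x
  have H1: "H \<phi> x = 1" for x using arg_cong[OF v, of "\<lambda>u. u $ x"] by (simp add: \<phi>_def[abs_def])
  \<comment> \<open>The off-diagonal entries of \<open>H\<close> are nonpositive, so \<open>H pos \<le> 0\<close> wherever \<open>neg > 0\<close>;
    hence \<open>H neg = H pos - 1\<close> pairs nonpositively with \<open>neg\<close>, and definiteness gives \<open>neg = 0\<close>.\<close>
  define neg where "neg x = max (- \<phi> x) 0" for x
  define pos where "pos x = max (\<phi> x) 0" for x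
  have pos_eq: "pos = (\<lambda>x. \<phi> x + neg x)" by (auto simp: pos_def neg_def max_def)
  have Hpos: "m x * H pos x * neg x \<le> 0" for x
  proof (cases "neg x = 0")
    case False
    then have "pos x = 0" by (auto simp: pos_def neg_def max_def split: if_splits)
    then have "laplacian w m pos x \<ge> 0"
      unfolding laplacian_def
      by (intro sum_nonneg mult_nonneg_nonneg divide_nonneg_pos)
         (auto simp: weight_nonneg measure_pos pos_def)
    then have "H pos x \<le> 0" using \<open>pos x = 0\<close> by (simp add: H_def)
    then show ?thesis using measure_pos[of x]
      by (intro mult_nonpos_nonneg mult_nonneg_nonpos) (auto simp: neg_def)
  qed simp
  have "(\<Sum>x\<in>UNIV. m x * H neg x * neg x) \<le> 0"
  proof (rule sum_nonpos)
    fix x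
    have *: "H neg x = H pos x - 1" by (simp add: pos_eq H_add H1)
    have "m x * H neg x * neg x = m x * H pos x * neg x - m x * neg x"
      unfolding * by (simp add: algebra_simps)
    also have "\<dots> \<le> 0" using Hpos[of x] measure_pos[of x]
      by (smt (verit) mult_nonneg_nonneg neg_def)
    finally show "m x * H neg x * neg x \<le> 0" .
  qed
  then have "neg x = 0" for x by (rule definite)
  then have nonneg: "\<phi> x \<ge> 0" for x
    by (metis neg_def max.cobounded1 neg_le_0_iff_le)
  have "\<phi> x > 0" for x
  proof (rule ccontr)
    assume "\<not> \<phi> x > 0"
    then have 0: "\<phi> x = 0" using nonneg[of x] by simp
    then have "laplacian w m \<phi> x \<ge> 0"
      unfolding laplacian_def
      by (intro sum_nonneg mult_nonneg_nonneg divide_nonneg_pos)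
         (auto simp: weight_nonneg measure_pos nonneg)
    then show False using H1[of x] 0 by (simp add: H_def)
  qed
  moreover have "laplacian w m \<phi> x - 2 * \<rho> x * \<phi> x = -2" for x
    using H1[of x] by (simp add: H_def)
  ultimately show ?thesis using that by blast
qed

section \<open>Curvature and diameter of covers\<close>

text \<open>A covering graph, given by its unique lifting of edges: a point \<open>x\<close> of the cover lies over \<open>pr x\<close>, and
\<open>lift x y\<close> is the end point of the lift from \<open>x\<close> of the edge from \<open>pr x\<close> to \<open>y\<close>. The triangle and square
conditions say that closed walks of length 3 and 4 lift to closed walks. They are what makes the
cover look like the base graph to \<open>\<Gamma>\<^sub>2\<close>.\<close>

locale graph_cover = mwg w m for w :: "'v::finite \<Rightarrow> 'v \<Rightarrow> real" and m +
  fixes S :: "'a set" and pr :: "'a \<Rightarrow> 'v" and lift :: "'a \<Rightarrow> 'v \<Rightarrow> 'a" and b :: 'a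
  assumes base_in: "b \<in> S"
    and lift_in: "x \<in> S \<Longrightarrow> adjacent w (pr x) y \<Longrightarrow> lift x y \<in> S"
    and pr_lift: "x \<in> S \<Longrightarrow> adjacent w (pr x) y \<Longrightarrow> pr (lift x y) = y"
    and lift_back: "x \<in> S \<Longrightarrow> adjacent w (pr x) y \<Longrightarrow> lift (lift x y) (pr x) = x"
    and lift_triangle: "x \<in> S \<Longrightarrow> adjacent w (pr x) y \<Longrightarrow> adjacent w y z \<Longrightarrow> adjacent w (pr x) z
       \<Longrightarrow> lift (lift x y) z = lift x z"
    and lift_square: "x \<in> S \<Longrightarrow> adjacent w (pr x) y \<Longrightarrow> adjacent w y z \<Longrightarrow> adjacent w (pr x) y'
       \<Longrightarrow> adjacent w y' z \<Longrightarrow> z \<noteq> pr x \<Longrightarrow> y \<noteq> y' \<Longrightarrow> lift (lift x y) z = lift (lift x y') z"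
    and reachable: "x \<in> S \<Longrightarrow> (\<lambda>x x'. \<exists>y. adjacent w (pr x) y \<and> x' = lift x y)\<^sup>*\<^sup>* b x"
begin

text \<open>These are the Laplacian and the \<open>\<Gamma>\<close>-operator of the cover, with the weights and the measure lifted
from the base.\<close>

definition lap :: "('a \<Rightarrow> real) \<Rightarrow> 'a \<Rightarrow> real" where
  "lap f x = (\<Sum>y | adjacent w (pr x) y. w (pr x) y / m (pr x) * (f (lift x y) - f x))"

definition gam :: "('a \<Rightarrow> real) \<Rightarrow> ('a \<Rightarrow> real) \<Rightarrow> 'a \<Rightarrow> real" where
  "gam f g x = 1/2 * (\<Sum>y | adjacent w (pr x) y.
     w (pr x) y / m (pr x) * ((f (lift x y) - f x) * (g (lift x y) - g x)))"

lemma adjacent_sym: "adjacent w x y \<longleftrightarrow> adjacent w y x"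
  by (simp add: adjacent_def weight_sym)

lemma adjacent_irrefl: "\<not> adjacent w x x"
  by (simp add: adjacent_def weight_diag)

lemma carre_du_champ_eq:
  "carre_du_champ w m f g x =
     1/2 * (\<Sum>y | adjacent w x y. w x y / m x * ((f y - f x) * (g y - g x)))"
proof -
  have "laplacian w m (\<lambda>z. f z * g z) x - f x * laplacian w m g x - g x * laplacian w m f x
    = (\<Sum>y | adjacent w x y. w x y / m x * (f y * g y - f x * g x)
        - f x * (w x y / m x * (g y - g x)) - g x * (w x y / m x * (f y - f x)))"
    by (simp only: laplacian_def sum_distrib_left sum_subtractf)
  also have "\<dots> = (\<Sum>y | adjacent w x y. w x y / m x * ((f y - f x) * (g y - g x)))"
    by (intro sum.cong refl) (simp add: algebra_simps diff_divide_distrib)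
  finally show ?thesis by (simp add: carre_du_champ_def)
qed

text \<open>The curvature condition at \<open>pr x\<close> involves a function only through its values at the end points of
walks of length at most 2 from \<open>pr x\<close>. Closed walks of length 2, 3 and 4 lift to closed walks, so
the end point of such a lifted walk depends on its projected end point only, and a function on the cover can be
transported to the base without changing any of these values. As the base is finite, boundedness
of the transported function is automatic.\<close>

lemma curvature_lift:
  assumes CD: "curvature_dimension w m \<rho> n" and n: "n > 0" and x: "x \<in> S"
  shows "lap (gam f f) x - 2 * gam f (lap f) x \<ge> 2 * \<rho> (pr x) * gam f f x"
proof -
  let ?x = "pr x"
  \<comment> \<open>The transported function; points at distance more than 2 get the default value 0.\<close>
  define F where "F z = (if z = ?x then f x else if adjacent w ?x z then f (lift x z)
     else if \<exists>y. adjacent w ?x y \<and> adjacent w y z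
       then f (lift (lift x (SOME y. adjacent w ?x y \<and> adjacent w y z)) z) else 0)" for z
  have F0: "F ?x = f x" by (simp add: F_def)
  have F1: "F y = f (lift x y)" if "adjacent w ?x y" for y
    using that adjacent_irrefl by (auto simp: F_def)
  have F2: "F z = f (lift (lift x y) z)" if y: "adjacent w ?x y" and z: "adjacent w y z" for y z
  proof -
    consider "z = ?x" | "adjacent w ?x z" | "z \<noteq> ?x" "\<not> adjacent w ?x z" by blast
    then show ?thesis
    proof cases
      case 1 then show ?thesis using lift_back[OF x y] F0 by simp
    next
      case 2 then show ?thesis using lift_triangle[OF x y z] F1 by simp
    next
      case 3
      have ex: "(\<exists>y. adjacent w ?x y \<and> adjacent w y z) = True" using y z by blast
      define y' where "y' = (SOME y. adjacent w ?x y \<and> adjacent w y z)"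
      have y': "adjacent w ?x y' \<and> adjacent w y' z"
        unfolding y'_def using y z
        by (intro someI[where P = "\<lambda>y. adjacent w ?x y \<and> adjacent w y z" and x = y] conjI)
      have "F z = f (lift (lift x y') z)"
        using 3 y z unfolding F_def y'_def[symmetric] by (simp only: if_False if_True simp_thms ex) 
      also have "\<dots> = f (lift (lift x y) z)"
      proof (cases "y = y'")
        case False
        show ?thesis
          using lift_square[OF x y z conjunct1[OF y'] conjunct2[OF y'] 3(1) False] by simp
      qed simp
      finally show ?thesis .
    qed
  qed
  have lapF: "laplacian w m F y = lap f (lift x y)" if y: "adjacent w ?x y" for y
    unfolding laplacian_def lap_def pr_lift[OF x y] F1[OF y]
    by (rule sum.cong) (simp_all add: F2[OF y])
  have gamF: "carre_du_champ w m F F y = gam f f (lift x y)" if y: "adjacent w ?x y" for y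
    unfolding carre_du_champ_eq gam_def pr_lift[OF x y] F1[OF y]
    by (simp add: F2[OF y] cong: sum.cong_simp)
  have lapF0: "laplacian w m F ?x = lap f x"
    unfolding laplacian_def lap_def F0
    by (rule sum.cong) (simp_all add: F1)
  have gamF0: "carre_du_champ w m F F ?x = gam f f x"
    unfolding carre_du_champ_eq gam_def F0
    by (simp add: F1 cong: sum.cong_simp)
  have "carre_du_champ w m F (laplacian w m F) ?x = gam f (lap f) x"
    unfolding carre_du_champ_eq[of F] gam_def lapF0 F0
    by (simp add: F1 lapF cong: sum.cong_simp)
  moreover have "laplacian w m (carre_du_champ w m F F) ?x = lap (gam f f) x"
    unfolding laplacian_def[of w m "carre_du_champ w m F F"] lap_def[of "gam f f"] gamF0
    by (rule sum.cong) (simp_all add: gamF)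
  ultimately have "carre_du_champ2 w m F F ?x = 1/2 * (lap (gam f f) x - 2 * gam f (lap f) x)"
    by (simp add: carre_du_champ2_def)
  moreover have "carre_du_champ2 w m F F ?x \<ge> \<rho> ?x * gam f f x
       + real_of_ereal (1 / n) * (laplacian w m F ?x)\<^sup>2"
    using CD finite_imp_bounded[of "range F"] unfolding curvature_dimension_def
    by (auto simp flip: gamF0)
  moreover have "real_of_ereal (1 / n) * (laplacian w m F ?x)\<^sup>2 \<ge> 0"
    using n by (intro mult_nonneg_nonneg real_of_ereal_pos) (auto simp: zero_le_divide_ereal)
  ultimately have "\<rho> ?x * gam f f x \<le> 1/2 * (lap (gam f f) x - 2 * gam f (lap f) x)" by linarith
  then show ?thesis by simp
qed

text \<open>The degrees of the graph weighted by the rates \<open>w x y / m x\<close>; finiteness of the base bounds them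
uniformly on the cover.\<close>

definition vdeg :: "'v \<Rightarrow> real" where
  "vdeg x = (\<Sum>y | adjacent w x y. w x y / m x)"

definition maxdeg :: real where
  "maxdeg = Max (range vdeg)"

lemma vdeg_nonneg: "vdeg x \<ge> 0"
  unfolding vdeg_def by (intro sum_nonneg divide_nonneg_pos) (auto simp: weight_nonneg measure_pos)

lemma vdeg_le: "vdeg x \<le> maxdeg"
  unfolding maxdeg_def by (rule Max_ge) auto

lemma maxdeg_nonneg: "maxdeg \<ge> 0"
  using vdeg_nonneg vdeg_le order_trans by blast

lemma rate_nonneg: "w x y / m x \<ge> 0"
  using weight_nonneg measure_pos by (simp add: less_imp_le)

lemma gam_nonneg: "gam f f x \<ge> 0"
  unfolding gam_def by (intro mult_nonneg_nonneg sum_nonneg rate_nonneg zero_le_square) simp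

lemma lap_squared_le: "(lap f x)\<^sup>2 \<le> 2 * maxdeg * gam f f x"
proof -
  let ?A = "{y. adjacent w (pr x) y}"
  let ?q = "\<lambda>y. w (pr x) y / m (pr x)"
  let ?d = "\<lambda>y. f (lift x y) - f x"
  have "lap f x = (\<Sum>y\<in>?A. sqrt (?q y) * (sqrt (?q y) * ?d y))"
    unfolding lap_def mult.assoc[symmetric] real_sqrt_mult_self abs_of_nonneg[OF rate_nonneg] ..
  then have "(lap f x)\<^sup>2 \<le> (\<Sum>y\<in>?A. (sqrt (?q y))\<^sup>2) * (\<Sum>y\<in>?A. (sqrt (?q y) * ?d y)\<^sup>2)"
    by (simp only: Cauchy_Schwarz_ineq_sum)
  also have "(\<Sum>y\<in>?A. (sqrt (?q y))\<^sup>2) = vdeg (pr x)"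
    unfolding vdeg_def by (intro sum.cong refl) (rule real_sqrt_pow2[OF rate_nonneg])
  also have "(\<Sum>y\<in>?A. (sqrt (?q y) * ?d y)\<^sup>2) = 2 * gam f f x"
    unfolding gam_def power_mult_distrib
    unfolding real_sqrt_pow2[OF rate_nonneg] by (simp add: power2_eq_square)
  also have "vdeg (pr x) * (2 * gam f f x) \<le> maxdeg * (2 * gam f f x)"
    by (intro mult_right_mono vdeg_le) (simp add: gam_nonneg)
  finally show ?thesis by (simp add: algebra_simps)
qed

lemma gam_le_sup:
  assumes x: "x \<in> S" and g: "\<And>y. y \<in> S \<Longrightarrow> (g y)\<^sup>2 \<le> c"
  shows "gam g g x \<le> 2 * maxdeg * c"
proof -
  have c: "c \<ge> 0" using g[OF x] zero_le_power2 order_trans by blast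
  have "gam g g x \<le> 1/2 * (\<Sum>y | adjacent w (pr x) y. w (pr x) y / m (pr x) * (4 * c))"
    unfolding gam_def
  proof (intro mult_left_mono sum_mono rate_nonneg)
    fix y assume "y \<in> {y. adjacent w (pr x) y}"
    then have "(g (lift x y))\<^sup>2 \<le> c" using g lift_in[OF x] by simp
    moreover have "(g x)\<^sup>2 \<le> c" using g x by simp
    moreover have "(g (lift x y) - g x)\<^sup>2 + (g (lift x y) + g x)\<^sup>2 = 2 * (g (lift x y))\<^sup>2 + 2 * (g x)\<^sup>2"
      by (simp add: power2_eq_square algebra_simps)
    ultimately show "(g (lift x y) - g x) * (g (lift x y) - g x) \<le> 4 * c"
      using zero_le_power2[of "g (lift x y) + g x"] unfolding power2_eq_square by linarith
  qed simp
  also have "\<dots> = 2 * vdeg (pr x) * c"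
    by (simp add: vdeg_def sum_distrib_left sum_distrib_right algebra_simps)
  also have "\<dots> \<le> 2 * maxdeg * c"
    using vdeg_le c by (intro mult_right_mono) auto
  finally show ?thesis .
qed

lemma gam_euler_step:
  "gam (\<lambda>z. f z + e * g z) (\<lambda>z. f z + e * g z) x = gam f f x + 2 * e * gam f g x + e\<^sup>2 * gam g g x"
proof -
  have "q * (((a + e * c) - (a' + e * c')) * ((a + e * c) - (a' + e * c')))
      = q * ((a - a') * (a - a')) + 2 * e * (q * ((a - a') * (c - c')))
        + e\<^sup>2 * (q * ((c - c') * (c - c')))" for q a a' c c' :: real
    by algebra
  then show ?thesis
    unfolding gam_def by (simp only: sum.distrib sum_distrib_left[symmetric]) (simp add: algebra_simps)
qed

text \<open>A discrete-time version of the semigroup estimate \<open>\<Gamma> (P\<^sub>t f) \<le> exp (- t (L + 2 \<rho>)) (\<Gamma> f)\<close>. One Euler step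
changes the gradient by
\<open>\<Gamma> (f + e \<Delta> f) = \<Gamma> f + 2 e \<Gamma> (f, \<Delta> f) + e\<^sup>2 \<Gamma> (\<Delta> f)\<close>, and the curvature condition bounds the middle term by
\<open>e (\<Delta> \<Gamma> f - 2 \<rho> \<Gamma> f)\<close>. For small \<open>e\<close> the operator \<open>1 + e (\<Delta> - 2 \<rho>)\<close> has nonnegative entries, so it
preserves the bound \<open>\<Gamma> f \<le> N \<phi>\<close> and improves it by \<open>2 e N\<close>, because \<open>(\<Delta> - 2 \<rho>) \<phi> = -2\<close>. The quadratic error
costs at most half of this gain. What remains of the gain is a fixed fraction of \<open>N \<phi>\<close>.\<close>

lemma gradient_contraction:
  assumes CD: "curvature_dimension w m \<rho> n" and n: "n > 0"
    and \<phi>_pos: "\<And>x. \<phi> x > 0"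
    and \<phi>_super: "\<And>x. laplacian w m \<phi> x - 2 * \<rho> x * \<phi> x = -2"
  shows "\<exists>e>0. \<exists>\<theta>\<ge>0. \<theta> < 1 \<and> (\<forall>f N. N \<ge> 0 \<longrightarrow> (\<forall>x\<in>S. gam f f x \<le> N * \<phi> (pr x)) \<longrightarrow>
      (\<forall>x\<in>S. gam (\<lambda>z. f z + e * lap f z) (\<lambda>z. f z + e * lap f z) x \<le> \<theta> * N * \<phi> (pr x)))"
proof -
  define M where "M = Max (range \<phi>)"
  define R where "R = Max (range (\<lambda>x. \<bar>\<rho> x\<bar>))"
  have \<phi>_le: "\<phi> x \<le> M" for x unfolding M_def by (rule Max_ge) auto
  have \<rho>_le: "\<bar>\<rho> x\<bar> \<le> R" for x unfolding R_def by (rule Max_ge) auto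
  have M: "M > 0" using \<phi>_pos \<phi>_le less_le_trans by blast
  have R: "R \<ge> 0" using \<rho>_le abs_ge_zero order_trans by blast
  define B where "B = 4 * maxdeg\<^sup>2 * M"
  have B: "B \<ge> 0" using M by (simp add: B_def)
  \<comment> \<open>Three demands fix the step size: \<open>e * B \<le> 1\<close> absorbs the quadratic error, the second term in the
    minimum also keeps \<open>1 - e * vdeg x - 2 * e * \<rho> x\<close> nonnegative, and \<open>e \<le> M\<close> gives \<open>\<theta> \<ge> 0\<close>.\<close>
  define e where "e = min M (1 / (1 + B + maxdeg + 2 * R))"
  have den: "1 + B + maxdeg + 2 * R > 0" using B R maxdeg_nonneg by linarith
  have e: "e > 0" using M den by (simp add: e_def)
  have "e \<le> 1 / (1 + B + maxdeg + 2 * R)" by (simp add: e_def)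
  then have e_le: "e * (1 + B + maxdeg + 2 * R) \<le> 1"
    using den by (simp add: pos_le_divide_eq)
  have e1: "e * B \<le> 1"
  proof -
    have "e * B \<le> e * (1 + B + maxdeg + 2 * R)"
      using e R maxdeg_nonneg by (intro mult_left_mono) auto
    then show ?thesis using e_le by linarith
  qed
  have e2: "1 - e * vdeg x - 2 * e * \<rho> x \<ge> 0" for x
  proof -
    have "e * (vdeg x + 2 * \<rho> x) \<le> e * (1 + B + maxdeg + 2 * R)"
      using e B vdeg_le[of x] \<rho>_le[of x] by (intro mult_left_mono) auto
    then show ?thesis using e_le by (simp add: algebra_simps)
  qed
  define \<theta> where "\<theta> = 1 - e / M"
  have \<theta>: "0 \<le> \<theta>" "\<theta> < 1"
    using e M by (auto simp: \<theta>_def e_def)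
  have "gam (\<lambda>z. f z + e * lap f z) (\<lambda>z. f z + e * lap f z) x \<le> \<theta> * N * \<phi> (pr x)"
    if N: "N \<ge> 0" and f: "\<And>z. z \<in> S \<Longrightarrow> gam f f z \<le> N * \<phi> (pr z)" and x: "x \<in> S" for f N x
  proof -
    let ?x = "pr x"
    let ?q = "\<lambda>y. w ?x y / m ?x"
    have f': "gam f f z \<le> N * M" if "z \<in> S" for z
      using f[OF that] \<phi>_le N by (meson mult_left_mono order_trans)
    have "(lap f z)\<^sup>2 \<le> 2 * maxdeg * (N * M)" if "z \<in> S" for z
      using lap_squared_le[of f z] f'[OF that] maxdeg_nonneg
      by (meson mult_left_mono mult_nonneg_nonneg order_trans zero_le_numeral)
    then have "gam (lap f) (lap f) x \<le> 2 * maxdeg * (2 * maxdeg * (N * M))"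
      by (rule gam_le_sup[OF x])
    then have quad: "gam (lap f) (lap f) x \<le> N * B"
      by (simp add: B_def power2_eq_square mult_ac)
    have lap_split: "lap g x = (\<Sum>y | adjacent w ?x y. ?q y * g (lift x y)) - vdeg ?x * g x" for g
      by (simp add: lap_def vdeg_def sum_distrib_right right_diff_distrib sum_subtractf)
    have lap_split': "laplacian w m \<phi> ?x = (\<Sum>y | adjacent w ?x y. ?q y * \<phi> y) - vdeg ?x * \<phi> ?x"
      by (simp add: laplacian_def vdeg_def sum_distrib_right right_diff_distrib sum_subtractf)
    have "(\<Sum>y | adjacent w ?x y. ?q y * gam f f (lift x y)) \<le> (\<Sum>y | adjacent w ?x y. ?q y * (N * \<phi> y))"
      using f[OF lift_in[OF x]] pr_lift[OF x]
      by (intro sum_mono mult_left_mono rate_nonneg) auto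
    also have "\<dots> = N * (\<Sum>y | adjacent w ?x y. ?q y * \<phi> y)"
      by (simp add: sum_distrib_left mult_ac)
    also have "\<dots> = N * (-2 + 2 * \<rho> ?x * \<phi> ?x + vdeg ?x * \<phi> ?x)"
      using \<phi>_super[of ?x] lap_split' by simp
    finally have nbr: "e * (\<Sum>y | adjacent w ?x y. ?q y * gam f f (lift x y))
        \<le> e * (N * (-2 + 2 * \<rho> ?x * \<phi> ?x + vdeg ?x * \<phi> ?x))"
      using e by (intro mult_left_mono) auto
    have centre: "(1 - e * vdeg ?x - 2 * e * \<rho> ?x) * gam f f x
        \<le> (1 - e * vdeg ?x - 2 * e * \<rho> ?x) * (N * \<phi> ?x)"
      by (intro mult_left_mono f x e2)
    have curv: "e * (2 * gam f (lap f) x) \<le> e * (lap (gam f f) x - 2 * \<rho> ?x * gam f f x)"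
      using curvature_lift[OF CD n x, of f] e by (intro mult_left_mono) auto
    have quad': "e\<^sup>2 * gam (lap f) (lap f) x \<le> N * e"
    proof -
      have "e\<^sup>2 * gam (lap f) (lap f) x \<le> e\<^sup>2 * (N * B)"
        by (intro mult_left_mono quad) auto
      also have "\<dots> = (N * e) * (e * B)" by (simp add: power2_eq_square mult_ac)
      also have "\<dots> \<le> (N * e) * 1" using e1 N e by (intro mult_left_mono) auto
      finally show ?thesis by simp
    qed
    have "gam (\<lambda>z. f z + e * lap f z) (\<lambda>z. f z + e * lap f z) x
        = gam f f x + e * (2 * gam f (lap f) x) + e\<^sup>2 * gam (lap f) (lap f) x"
      by (simp add: gam_euler_step mult_ac)
    also have "\<dots> \<le> gam f f x + e * (lap (gam f f) x - 2 * \<rho> ?x * gam f f x) + N * e"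
      using curv quad' by linarith
    also have "\<dots> = (1 - e * vdeg ?x - 2 * e * \<rho> ?x) * gam f f x
        + e * (\<Sum>y | adjacent w ?x y. ?q y * gam f f (lift x y)) + N * e"
      unfolding lap_split[of "gam f f"] by (simp add: algebra_simps)
    also have "\<dots> \<le> (1 - e * vdeg ?x - 2 * e * \<rho> ?x) * (N * \<phi> ?x)
        + e * (N * (-2 + 2 * \<rho> ?x * \<phi> ?x + vdeg ?x * \<phi> ?x)) + N * e"
      using nbr centre by linarith
    also have "\<dots> = N * (\<phi> ?x - e)" by (simp add: algebra_simps)
    also have "\<dots> \<le> N * (\<phi> ?x - e * (\<phi> ?x / M))"
    proof -
      have "e * (\<phi> ?x / M) \<le> e * 1"
        using \<phi>_le[of ?x] M e by (intro mult_left_mono) auto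
      then show ?thesis using N by (intro mult_left_mono) auto
    qed
    also have "\<dots> = \<theta> * N * \<phi> ?x" by (simp add: \<theta>_def algebra_simps)
    finally show ?thesis .
  qed
  then have "\<forall>f N. N \<ge> 0 \<longrightarrow> (\<forall>x\<in>S. gam f f x \<le> N * \<phi> (pr x)) \<longrightarrow>
      (\<forall>x\<in>S. gam (\<lambda>z. f z + e * lap f z) (\<lambda>z. f z + e * lap f z) x \<le> \<theta> * N * \<phi> (pr x))" by blast
  with e \<theta> show ?thesis by (intro exI conjI)
qed

text \<open>Iterate the Euler step on the distance from the base point, a function with bounded gradient. The
gradients of the iterates decay geometrically. Hence so do the increments, and the iterates
stay within a bounded distance of the initial function; yet they become flat in the limit. So the
distance function is bounded, and a bounded cover of a finite graph is finite.\<close>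

lemma finite_cover:
  assumes CD: "curvature_dimension w m \<rho> n" and n: "n > 0"
    and \<phi>_pos: "\<And>x. \<phi> x > 0"
    and \<phi>_super: "\<And>x. laplacian w m \<phi> x - 2 * \<rho> x * \<phi> x = -2"
  shows "finite S"
proof -
  obtain e \<theta> where e: "e > 0" and \<theta>: "0 \<le> \<theta>" "\<theta> < 1"
    and contr: "\<forall>f N. N \<ge> 0 \<longrightarrow> (\<forall>x\<in>S. gam f f x \<le> N * \<phi> (pr x)) \<longrightarrow>
      (\<forall>x\<in>S. gam (\<lambda>z. f z + e * lap f z) (\<lambda>z. f z + e * lap f z) x \<le> \<theta> * N * \<phi> (pr x))"
    using gradient_contraction[where \<phi> = \<phi>, OF CD n \<phi>_pos \<phi>_super] by (elim exE conjE)
  define step where "step x x' \<longleftrightarrow> (\<exists>y. adjacent w (pr x) y \<and> x' = lift x y)" for x x'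
  define sphere where "sphere k = {x. (step ^^ k) b x}" for k
  have sphere_S: "sphere k \<subseteq> S" for k
  proof (induction k)
    case 0 then show ?case by (auto simp: sphere_def base_in)
  next
    case (Suc k)
    then show ?case by (auto simp: sphere_def step_def relcompp_apply intro!: lift_in)
  qed
  have finite_sphere: "finite (sphere k)" for k
  proof (induction k)
    case 0
    have "sphere 0 = {b}" by (auto simp: sphere_def)
    then show ?case by simp
  next
    case (Suc k)
    have "sphere (Suc k) \<subseteq> (\<Union>x\<in>sphere k. range (lift x))"
      by (auto simp: sphere_def step_def relcompp_apply)
    then show ?case by (rule finite_subset) (use Suc in auto)
  qed
  define dist where "dist x = (LEAST k. x \<in> sphere k)" for x
  have dist: "x \<in> sphere (dist x)" if "x \<in> S" for x
  proof -
    have "\<exists>k. x \<in> sphere k"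
      using reachable[OF that] unfolding sphere_def step_def[abs_def, symmetric]
      by (simp add: rtranclp_power)
    then show ?thesis unfolding dist_def by (rule LeastI_ex)
  qed
  have dist_lift: "dist (lift x y) \<le> Suc (dist x)" if "x \<in> S" "adjacent w (pr x) y" for x y
  proof -
    have "lift x y \<in> sphere (Suc (dist x))"
      using dist[OF that(1)] that(2) unfolding sphere_def mem_Collect_eq
      by (intro relpowp_Suc_I) (auto simp: step_def)
    then show ?thesis unfolding dist_def by (rule Least_le)
  qed
  have dist_lift': "dist x \<le> Suc (dist (lift x y))" if "x \<in> S" "adjacent w (pr x) y" for x y
    using dist_lift[OF lift_in[OF that], of "pr x"] lift_back[OF that] pr_lift[OF that] that(2)
    by (simp add: adjacent_sym)
  define d where "d x = real (dist x)" for x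
  define p where "p = Min (range \<phi>)"
  define M where "M = Max (range \<phi>)"
  have \<phi>_le: "\<phi> x \<le> M" for x unfolding M_def by (rule Max_ge) auto
  have M: "M > 0" using \<phi>_pos \<phi>_le less_le_trans by blast
  have p_le: "p \<le> \<phi> x" for x unfolding p_def by (rule Min_le) auto
  have p: "p > 0" unfolding p_def using \<phi>_pos by (subst Min_gr_iff) auto
  define N where "N = maxdeg / (2 * p)"
  have N: "N \<ge> 0" using maxdeg_nonneg p by (simp add: N_def)
  have gam_d: "gam d d x \<le> N * \<phi> (pr x)" if x: "x \<in> S" for x
  proof -
    have "gam d d x \<le> 1/2 * (\<Sum>y | adjacent w (pr x) y. w (pr x) y / m (pr x) * 1)"
      unfolding gam_def
    proof (intro mult_left_mono sum_mono rate_nonneg)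
      fix y assume "y \<in> {y. adjacent w (pr x) y}"
      then have "\<bar>d (lift x y) - d x\<bar> \<le> 1"
        using dist_lift[OF x, of y] dist_lift'[OF x, of y] by (auto simp: d_def)
      then show "(d (lift x y) - d x) * (d (lift x y) - d x) \<le> 1"
        by (metis abs_ge_zero abs_mult_self_eq mult_le_one)
    qed simp
    also have "\<dots> \<le> maxdeg / 2" using vdeg_le[of "pr x"] by (simp add: vdeg_def)
    also have "\<dots> = N * p" using p by (simp add: N_def)
    also have "\<dots> \<le> N * \<phi> (pr x)" by (intro mult_left_mono p_le N)
    finally show ?thesis .
  qed
  define F where "F k = ((\<lambda>f z. f z + e * lap f z) ^^ k) d" for k :: nat
  have F_Suc: "F (Suc k) = (\<lambda>z. F k z + e * lap (F k) z)" for k by (simp add: F_def)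
  have gam_F: "gam (F k) (F k) x \<le> (\<theta> ^ k * N) * \<phi> (pr x)" if "x \<in> S" for k x
    using that
  proof (induction k arbitrary: x)
    case 0 then show ?case using gam_d by (simp add: F_def)
  next
    case (Suc k)
    then show ?case
      using contr[rule_format, of "\<theta> ^ k * N" "F k" x] \<theta> N by (simp add: F_Suc mult_ac)
  qed
  have gam_F': "gam (F k) (F k) x \<le> \<theta> ^ k * (N * M)" if "x \<in> S" for k x
  proof -
    have "(\<theta> ^ k * N) * \<phi> (pr x) \<le> (\<theta> ^ k * N) * M"
      using \<theta> N by (intro mult_left_mono \<phi>_le) auto
    then show ?thesis using gam_F[OF that, of k] by (simp add: mult_ac)
  qed
  define r where "r = sqrt \<theta>"
  have r: "0 \<le> r" "r < 1" using \<theta> by (auto simp: r_def)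
  define A where "A = e * sqrt (2 * maxdeg * (N * M))"
  have A: "A \<ge> 0" using e maxdeg_nonneg N M by (simp add: A_def)
  have increment: "\<bar>F (Suc k) x - F k x\<bar> \<le> A * r ^ k" if "x \<in> S" for k x
  proof -
    have "(lap (F k) x)\<^sup>2 \<le> 2 * maxdeg * (\<theta> ^ k * (N * M))"
      using lap_squared_le[of "F k" x] gam_F'[OF that, of k] maxdeg_nonneg
      by (meson mult_left_mono mult_nonneg_nonneg order_trans zero_le_numeral)
    then have "\<bar>lap (F k) x\<bar> \<le> sqrt (2 * maxdeg * (\<theta> ^ k * (N * M)))"
      by (simp add: real_le_rsqrt)
    also have "\<dots> = sqrt (2 * maxdeg * (N * M)) * r ^ k"
      unfolding r_def by (simp add: real_sqrt_mult real_sqrt_power mult_ac)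
    finally have "e * \<bar>lap (F k) x\<bar> \<le> e * (sqrt (2 * maxdeg * (N * M)) * r ^ k)"
      using e by (intro mult_left_mono) auto
    then show ?thesis using e by (simp add: F_Suc A_def abs_mult mult_ac)
  qed
  have drift: "\<bar>F k x - d x\<bar> \<le> A / (1 - r)" if "x \<in> S" for k x
  proof -
    have "\<bar>F k x - d x\<bar> \<le> A * (\<Sum>i<k. r ^ i)"
    proof (induction k)
      case 0 then show ?case by (simp add: F_def)
    next
      case (Suc k)
      then show ?case using increment[OF that, of k] by (simp add: distrib_left)
    qed
    also have "(\<Sum>i<k. r ^ i) \<le> 1 / (1 - r)"
      using r by (simp add: geometric_sum divide_right_mono_neg divide_le_eq field_simps)
    then have "A * (\<Sum>i<k. r ^ i) \<le> A * (1 / (1 - r))" by (intro mult_left_mono A)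
    finally show ?thesis by simp
  qed
  have flat: "(\<lambda>k. F k x - F k b) \<longlonglongrightarrow> 0" if "x \<in> S" for x
    using reachable[OF that] unfolding step_def[abs_def, symmetric]
  proof (induction rule: rtranclp_induct)
    case base then show ?case by simp
  next
    case (step x x')
    then have "x \<in> S"
      using sphere_S by (auto simp: rtranclp_power sphere_def)
    obtain y where y: "adjacent w (pr x) y" "x' = lift x y"
      using step.hyps by (auto simp: step_def)
    let ?q = "w (pr x) y / m (pr x)"
    have q: "?q > 0" using y measure_pos by (simp add: adjacent_def)
    have bound: "\<bar>F k x' - F k x\<bar> \<le> sqrt (2 * (N * M) / ?q) * r ^ k" for k
    proof -
      have "?q * ((F k x' - F k x) * (F k x' - F k x)) \<le> (\<Sum>y | adjacent w (pr x) y.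
          w (pr x) y / m (pr x) * ((F k (lift x y) - F k x) * (F k (lift x y) - F k x)))"
        unfolding y(2) using y(1)
        by (intro member_le_sum[where i = y and f = "\<lambda>y. w (pr x) y / m (pr x) * ((F k (lift x y) - F k x) * (F k (lift x y) - F k x))"]
             mult_nonneg_nonneg rate_nonneg zero_le_square) auto
      also have "\<dots> = 2 * gam (F k) (F k) x" by (simp add: gam_def)
      also have "\<dots> \<le> 2 * (\<theta> ^ k * (N * M))" using gam_F'[OF \<open>x \<in> S\<close>, of k] by simp
      finally have "(F k x' - F k x)\<^sup>2 \<le> 2 * (\<theta> ^ k * (N * M)) / ?q"
        by (subst pos_le_divide_eq[OF q]) (simp add: power2_eq_square mult_ac)
      then have "\<bar>F k x' - F k x\<bar> \<le> sqrt (2 * (\<theta> ^ k * (N * M)) / ?q)"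
        by (simp add: real_le_rsqrt)
      also have "2 * (\<theta> ^ k * (N * M)) / ?q = (2 * (N * M) / ?q) * \<theta> ^ k"
        by simp
      also have "sqrt \<dots> = sqrt (2 * (N * M) / ?q) * r ^ k"
        unfolding r_def by (simp only: real_sqrt_mult real_sqrt_power)
      finally show ?thesis .
    qed
    have "(\<lambda>k. F k x' - F k x) \<longlonglongrightarrow> 0"
    proof (rule Lim_null_comparison)
      show "\<forall>\<^sub>F k in sequentially. norm (F k x' - F k x) \<le> sqrt (2 * (N * M) / ?q) * r ^ k"
        using bound by simp
      show "(\<lambda>k. sqrt (2 * (N * M) / ?q) * r ^ k) \<longlonglongrightarrow> 0"
        using r by (intro tendsto_mult_right_zero LIMSEQ_realpow_zero)
    qed
    from tendsto_add[OF this step.IH] show ?case by simp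
  qed
  have "d x \<le> 2 * (A / (1 - r))" if "x \<in> S" for x
  proof (rule LIMSEQ_le_const)
    have "(\<lambda>k. 2 * (A / (1 - r)) + (F k x - F k b)) \<longlonglongrightarrow> 2 * (A / (1 - r)) + 0"
      by (intro tendsto_intros flat that)
    then show "(\<lambda>k. 2 * (A / (1 - r)) + (F k x - F k b)) \<longlonglongrightarrow> 2 * (A / (1 - r))" by simp
    have "dist b \<le> 0"
      unfolding dist_def by (rule Least_le) (auto simp: sphere_def)
    then have "d b = 0" by (simp add: d_def)
    have "d x \<le> 2 * (A / (1 - r)) + (F k x - F k b)" for k
      using drift[OF that, of k] drift[OF base_in, of k] \<open>d b = 0\<close> by linarith
    then show "\<exists>K. \<forall>k\<ge>K. d x \<le> 2 * (A / (1 - r)) + (F k x - F k b)" by blast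
  qed
  then have "S \<subseteq> (\<Union>k\<in>{..nat \<lfloor>2 * (A / (1 - r))\<rfloor>}. sphere k)"
    using dist by (fastforce simp: d_def le_nat_floor)
  then show ?thesis by (rule finite_subset) (use finite_sphere in auto)
qed

end

section \<open>The simplicial structure of the complex\<close>

text \<open>The complex is the realisation of an abstract simplicial complex: its vertices are those of the graph
and the apexes, and each disk is cut into the triangles spanned by the apex and the edges of its
polygon. The vertex \<open>s\<close> is the unit vector of the axis \<open>s\<close>, so coordinates are barycentric.\<close>

definition pt :: "'v + 'v set set \<Rightarrow> ('v::finite) complex_space" where
  "pt s = axis s 1"

definition simplices :: "('v::finite \<Rightarrow> 'v \<Rightarrow> real) \<Rightarrow> ('v + 'v set set) set set" where
  "simplices w = range (\<lambda>v. {Inl v}) \<union> (\<lambda>e. Inl ` e) ` graph_edges w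
     \<union> {insert (Inr C) (Inl ` e) | C e. C \<in> short_cycles w \<and> e \<in> C}"

abbreviation realisation :: "('v + 'v set set) set \<Rightarrow> ('v::finite) complex_space set" where
  "realisation \<sigma> \<equiv> convex hull (pt ` \<sigma>)"

lemma vertex_simplex: "{Inl v} \<in> simplices w"
  and edge_simplex: "e \<in> graph_edges w \<Longrightarrow> Inl ` e \<in> simplices w"
  and cone_simplex: "C \<in> short_cycles w \<Longrightarrow> e \<in> C \<Longrightarrow> insert (Inr C) (Inl ` e) \<in> simplices w"
  by (auto simp: simplices_def)

lemma simplices_cases:
  assumes "\<sigma> \<in> simplices w"
  obtains v where "\<sigma> = {Inl v}" | e where "e \<in> graph_edges w" "\<sigma> = Inl ` e"
    | C e where "C \<in> short_cycles w" "e \<in> C" "\<sigma> = insert (Inr C) (Inl ` e)"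
  using assms by (auto simp: simplices_def)

lemma vertex_point_eq: "vertex_point v = pt (Inl v)"
  and apex_point_eq: "apex_point C = pt (Inr C)"
  by (simp_all add: vertex_point_def apex_point_def pt_def)

lemma edge_segment_eq: "edge_segment e = realisation (Inl ` e)"
  by (simp add: edge_segment_def image_image vertex_point_eq)

lemma filled_polygon_eq: "filled_polygon C = (\<Union>e\<in>C. realisation (insert (Inr C) (Inl ` e)))"
  by (simp add: filled_polygon_def image_image vertex_point_eq apex_point_eq)

lemma short_cycle_edges:
  assumes "C \<in> short_cycles w" "e \<in> C"
  shows "e \<in> graph_edges w"
  using assms by (auto simp: short_cycles_def cycle_edges_def graph_cycle_def graph_edges_def)

lemma open_edge_subset: "e \<in> graph_edges w \<Longrightarrow> edge_segment e \<subseteq> graph_complex w"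
proof
  fix p assume "e \<in> graph_edges w" "p \<in> edge_segment e"
  then have "p \<in> edge_segment e - vertex_point ` e \<or> (\<exists>v. p \<in> {vertex_point v})" by blast
  then show "p \<in> graph_complex w"
    using \<open>e \<in> graph_edges w\<close> unfolding graph_complex_def open_cells_def by blast
qed

lemma graph_complex_eq: "graph_complex w = (\<Union>\<sigma>\<in>simplices w. realisation \<sigma>)"
proof
  show "graph_complex w \<subseteq> (\<Union>\<sigma>\<in>simplices w. realisation \<sigma>)"
  proof
    fix p assume "p \<in> graph_complex w"
    then consider v where "p = vertex_point v" | e where "e \<in> graph_edges w" "p \<in> edge_segment e"
      | C where "C \<in> short_cycles w" "p \<in> filled_polygon C"
      unfolding graph_complex_def open_cells_def by blast
    then show "p \<in> (\<Union>\<sigma>\<in>simplices w. realisation \<sigma>)"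
    proof cases
      case (1 v)
      then have "p \<in> realisation {Inl v}" by (simp add: vertex_point_eq)
      then show ?thesis using vertex_simplex by blast
    next
      case 2 then show ?thesis using edge_simplex unfolding edge_segment_eq by blast
    next
      case 3 then show ?thesis using cone_simplex unfolding filled_polygon_eq by blast
    qed
  qed
  show "(\<Union>\<sigma>\<in>simplices w. realisation \<sigma>) \<subseteq> graph_complex w"
  proof
    fix p assume "p \<in> (\<Union>\<sigma>\<in>simplices w. realisation \<sigma>)"
    then obtain \<sigma> where "\<sigma> \<in> simplices w" and p: "p \<in> realisation \<sigma>" by blast
    then consider v where "p = vertex_point v" | e where "e \<in> graph_edges w" "p \<in> edge_segment e"
      | C where "C \<in> short_cycles w" "p \<in> filled_polygon C"
    proof (cases rule: simplices_cases)
      case 1 then show ?thesis using p that(1) by (simp add: vertex_point_eq)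
    next
      case 2 then show ?thesis using p that(2) by (simp add: edge_segment_eq)
    next
      case 3 then show ?thesis using p that(3) unfolding filled_polygon_eq by blast
    qed
    then show "p \<in> graph_complex w"
    proof cases
      case 1 then show ?thesis unfolding graph_complex_def open_cells_def by blast
    next
      case 2 then show ?thesis using open_edge_subset by blast
    next
      case 3
      show ?thesis
      proof (cases "p \<in> polygon C")
        case True
        then show ?thesis
          using 3(1) short_cycle_edges open_edge_subset unfolding polygon_def by blast
      next
        case False
        then show ?thesis using 3 unfolding graph_complex_def open_cells_def by blast
      qed
    qed
  qed
qed

lemma realisation_subset: "\<sigma> \<in> simplices w \<Longrightarrow> realisation \<sigma> \<subseteq> graph_complex w"
  unfolding graph_complex_eq by blast

lemma pt_in_realisation: "s \<in> \<sigma> \<Longrightarrow> pt s \<in> realisation \<sigma>"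
  by (simp add: hull_inc)

lemma pt_nth: "pt s $ t = (if s = t then 1 else 0)"
  by (auto simp: pt_def axis_def)

lemma convex_coord:
  "convex {p :: real ^ 'n. p $ s = 0}" "convex {p :: real ^ 'n. p $ s \<ge> 0}" "convex {p :: real ^ 'n. p $ s > 0}"
    "convex {p :: real ^ 'n. (\<Sum>i\<in>UNIV. p $ i) = 1}"
proof -
  have "linear (\<lambda>p :: real ^ 'n. p $ s)" by (rule bounded_linear.linear[OF bounded_linear_vec_nth])
  from convex_linear_vimage[OF this convex_singleton[of 0]]
    convex_linear_vimage[OF this convex_real_interval(1)[of 0]]
    convex_linear_vimage[OF this convex_real_interval(3)[of 0]]
  show "convex {p :: real ^ 'n. p $ s = 0}" "convex {p :: real ^ 'n. p $ s \<ge> 0}" "convex {p :: real ^ 'n. p $ s > 0}"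
    by (simp_all add: vimage_def)
  have "linear (\<lambda>p :: real ^ 'n. \<Sum>i\<in>UNIV. p $ i)"
    by (intro linear_compose_sum ballI bounded_linear.linear[OF bounded_linear_vec_nth])
  from convex_linear_vimage[OF this convex_singleton[of 1]]
  show "convex {p :: real ^ 'n. (\<Sum>i\<in>UNIV. p $ i) = 1}"
    by (simp add: vimage_def)
qed

lemma realisation_nth_nonneg: "p \<in> realisation \<sigma> \<Longrightarrow> p $ s \<ge> 0"
proof -
  have "realisation \<sigma> \<subseteq> {p. p $ s \<ge> 0}"
    by (rule hull_minimal) (auto simp: convex_coord pt_nth)
  then show "p \<in> realisation \<sigma> \<Longrightarrow> p $ s \<ge> 0" by blast
qed

lemma realisation_nth_zero:
  assumes "p \<in> realisation \<sigma>" "s \<notin> \<sigma>"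
  shows "p $ s = 0"
proof -
  have "realisation \<sigma> \<subseteq> {p. p $ s = 0}"
    using assms(2) by (intro hull_minimal) (auto simp: convex_coord pt_nth)
  then show ?thesis using assms(1) by blast
qed

lemma exists_positive_coord:
  assumes "p \<in> realisation \<sigma>"
  obtains s where "p $ s > 0"
proof -
  have "realisation \<sigma> \<subseteq> {p. (\<Sum>s\<in>UNIV. p $ s) = 1}"
    by (rule hull_minimal) (auto simp: convex_coord pt_nth)
  then have sum1: "(\<Sum>s\<in>UNIV. p $ s) = 1" using assms by blast
  have "\<not> (\<forall>s. p $ s = 0)"
  proof
    assume "\<forall>s. p $ s = 0"
    then have "(\<Sum>s\<in>UNIV. p $ s) = 0" by simp
    then show False using sum1 by simp
  qed
  then obtain s where "p $ s \<noteq> 0" by blast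
  then show ?thesis
    using that[of s] realisation_nth_nonneg[OF assms, of s] by simp
qed

lemma graph_complex_simplex:
  assumes "p \<in> graph_complex w"
  obtains \<sigma> where "\<sigma> \<in> simplices w" "p \<in> realisation \<sigma>" "\<forall>s. p $ s > 0 \<longrightarrow> s \<in> \<sigma>"
proof -
  obtain \<sigma> where \<sigma>: "\<sigma> \<in> simplices w" "p \<in> realisation \<sigma>"
    using assms unfolding graph_complex_eq by blast
  show ?thesis
  proof (rule that[OF \<sigma>], intro allI impI)
    fix s assume "p $ s > 0"
    then show "s \<in> \<sigma>" using realisation_nth_zero[OF \<sigma>(2), of s] by (cases "s \<in> \<sigma>") auto
  qed
qed

lemma pt_in_complex: "\<sigma> \<in> simplices w \<Longrightarrow> s \<in> \<sigma> \<Longrightarrow> pt s \<in> graph_complex w"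
  using realisation_subset pt_in_realisation by blast

lemma vertex_in_complex: "pt (Inl v) \<in> graph_complex w"
  by (rule pt_in_complex[OF vertex_simplex]) simp

text \<open>The open star of \<open>s\<close>: relatively open, and star-shaped about the vertex \<open>s\<close>.\<close>

definition open_star :: "('v::finite \<Rightarrow> 'v \<Rightarrow> real) \<Rightarrow> 'v + 'v set set \<Rightarrow> 'v complex_space set" where
  "open_star w s = {p \<in> graph_complex w. p $ s > 0}"

lemma open_star_segment:
  assumes "p \<in> open_star w s"
  shows "closed_segment (pt s) p \<subseteq> open_star w s"
proof -
  have p: "p \<in> graph_complex w" "p $ s > 0" using assms by (auto simp: open_star_def)
  obtain \<sigma> where \<sigma>: "\<sigma> \<in> simplices w" "p \<in> realisation \<sigma>"
    and *: "\<forall>t. p $ t > 0 \<longrightarrow> t \<in> \<sigma>"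
    by (rule graph_complex_simplex[OF p(1)])
  have "closed_segment (pt s) p \<subseteq> realisation \<sigma>"
    using \<sigma>(2) pt_in_realisation[of s \<sigma>] * p(2) by (intro closed_segment_subset) auto
  moreover have "closed_segment (pt s) p \<subseteq> {p. p $ s > 0}"
    by (intro closed_segment_subset convex_coord) (auto simp: pt_nth p)
  ultimately show ?thesis
    using realisation_subset[OF \<sigma>(1)] unfolding open_star_def by blast
qed

lemma filled_polygon_subset: "C \<in> short_cycles w \<Longrightarrow> filled_polygon C \<subseteq> graph_complex w"
  unfolding filled_polygon_eq graph_complex_eq using cone_simplex by blast

lemma filled_polygon_segment:
  assumes "p \<in> filled_polygon C"
  shows "closed_segment (apex_point C) p \<subseteq> filled_polygon C"
proof -
  obtain e where e: "e \<in> C" "p \<in> realisation (insert (Inr C) (Inl ` e))"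
    using assms unfolding filled_polygon_eq by blast
  have "closed_segment (apex_point C) p \<subseteq> realisation (insert (Inr C) (Inl ` e))"
    using e by (intro closed_segment_subset) (auto simp: apex_point_eq hull_inc)
  then show ?thesis using e unfolding filled_polygon_eq by blast
qed

text \<open>All elementary homotopies in the complex come from here: two paths with the same ends inside a common
star-shaped piece of the complex are homotopic.\<close>

lemma starlike_homotopic_paths:
  fixes X :: "'a::real_normed_vector set"
  assumes a: "a \<in> D" "\<And>x. x \<in> D \<Longrightarrow> closed_segment a x \<subseteq> D" and "D \<subseteq> X"
    and "path p" "path_image p \<subseteq> D" "path q" "path_image q \<subseteq> D"
    and "pathstart q = pathstart p" "pathfinish q = pathfinish p"
  shows "homotopic_paths X p q"
proof -
  have "starlike D" using a unfolding starlike_def by blast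
  then have "simply_connected D" by (rule starlike_imp_simply_connected)
  then have "homotopic_paths D p q"
    using assms(4-) unfolding simply_connected_eq_homotopic_paths by blast
  then show ?thesis using \<open>D \<subseteq> X\<close> by (rule homotopic_paths_subset)
qed

lemma simplex_homotopic_paths:
  assumes "\<sigma> \<in> simplices w"
    and "path p" "path_image p \<subseteq> realisation \<sigma>" "path q" "path_image q \<subseteq> realisation \<sigma>"
    and "pathstart q = pathstart p" "pathfinish q = pathfinish p"
  shows "homotopic_paths (graph_complex w) p q"
proof (rule starlike_homotopic_paths)
  show "pathstart p \<in> realisation \<sigma>" using assms pathstart_in_path_image by blast
  then show "closed_segment (pathstart p) x \<subseteq> realisation \<sigma>" if "x \<in> realisation \<sigma>" for x
    using that by (intro closed_segment_subset) auto
qed (use assms realisation_subset[OF assms(1)] in simp_all)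

lemma filled_polygon_homotopic_paths:
  assumes "C \<in> short_cycles w"
    and p: "path p" "path_image p \<subseteq> filled_polygon C" "path q" "path_image q \<subseteq> filled_polygon C"
    and "pathstart q = pathstart p" "pathfinish q = pathfinish p"
  shows "homotopic_paths (graph_complex w) p q"
proof (rule starlike_homotopic_paths)
  show "apex_point C \<in> filled_polygon C"
    using filled_polygon_segment[of "pathstart p" C] p pathstart_in_path_image[of p] ends_in_segment by blast
qed (use assms filled_polygon_segment filled_polygon_subset[OF assms(1)] in simp_all)

lemma homotopic_paths_replace_end:
  assumes "homotopic_paths X p (q +++ l)" "homotopic_paths X (l +++ l') k"
    and "pathfinish q = pathstart l" "pathfinish l = pathstart l'"
  shows "homotopic_paths X (p +++ l') (q +++ k)"
proof -
  have q: "path q" "path l" "path l'" "path_image q \<subseteq> X" "path_image l \<subseteq> X" "path_image l' \<subseteq> X"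
    using homotopic_paths_imp_path[OF assms(1)] homotopic_paths_imp_subset[OF assms(1)]
      homotopic_paths_imp_path[OF assms(2)] homotopic_paths_imp_subset[OF assms(2)] assms(3,4)
    by (auto simp: path_image_join)
  have "pathfinish p = pathstart l'"
    using homotopic_paths_imp_pathfinish[OF assms(1)] assms(4) by simp
  then have "homotopic_paths X (p +++ l') ((q +++ l) +++ l')"
    using assms q by (intro homotopic_paths_join) auto
  also have "homotopic_paths X \<dots> (q +++ (l +++ l'))"
    using assms q by (subst homotopic_paths_sym_eq) (intro homotopic_paths_assoc, auto)
  also have "homotopic_paths X \<dots> (q +++ k)"
    using assms q by (intro homotopic_paths_join) auto
  finally show ?thesis .
qed

section \<open>Paths up to homotopy are edge paths\<close>

text \<open>A property that spreads along the edges of a cycle reaches the whole cycle.\<close>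

lemma cycle_edges_induct:
  assumes "x \<in> \<Union>(cycle_edges vs)" "P x" "y \<in> \<Union>(cycle_edges vs)"
    and step: "\<And>x y. {x, y} \<in> cycle_edges vs \<Longrightarrow> P x \<Longrightarrow> P y"
  shows "P y"
proof -
  let ?n = "length vs"
  have index: "\<exists>i<?n. z = vs ! i" if z: "z \<in> \<Union>(cycle_edges vs)" for z
  proof -
    obtain i where i: "i < ?n" "z \<in> {vs ! i, vs ! (Suc i mod ?n)}"
      using z unfolding cycle_edges_def by blast
    then have "Suc i mod ?n < ?n" by (intro mod_less_divisor) auto
    with i show ?thesis by blast
  qed
  obtain i where i: "i < ?n" "x = vs ! i" using index[OF assms(1)] by blast
  obtain j where j: "j < ?n" "y = vs ! j" using index[OF assms(3)] by blast
  have "P (vs ! ((i + k) mod ?n))" for k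
  proof (induction k)
    case 0 then show ?case using i assms(2) by simp
  next
    case (Suc k)
    let ?l = "(i + k) mod ?n"
    have "?l < ?n" using i by (intro mod_less_divisor) auto
    then have "{vs ! ?l, vs ! (Suc ?l mod ?n)} \<in> cycle_edges vs"
      unfolding cycle_edges_def by blast
    moreover have "Suc ?l mod ?n = (i + Suc k) mod ?n" by (simp add: mod_Suc_eq)
    ultimately show ?case using step[OF _ Suc] by simp
  qed
  from this[of "j + (?n - i)"] show ?thesis using i j by simp
qed

lemma short_cycle_induct:
  assumes "C \<in> short_cycles w" "x \<in> \<Union>C" "P x" "y \<in> \<Union>C"
    and "\<And>x y. {x, y} \<in> C \<Longrightarrow> P x \<Longrightarrow> P y"
  shows "P y"
proof -
  obtain vs where "C = cycle_edges vs" using assms(1) unfolding short_cycles_def by blast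
  then show ?thesis using cycle_edges_induct[of x vs P y] assms by blast
qed

text \<open>Edge paths run along the edges of the graph, from \<open>vertex_point a\<close> to the vertex recorded in the last
argument. Simplicial paths may
also pass through apexes, and they may pause at a vertex.\<close>

inductive edge_path :: "('v::finite \<Rightarrow> 'v \<Rightarrow> real) \<Rightarrow> 'v \<Rightarrow> (real \<Rightarrow> 'v complex_space) \<Rightarrow> 'v \<Rightarrow> bool"
  for w a where
  edge_path_refl: "edge_path w a (linepath (vertex_point a) (vertex_point a)) a"
| edge_path_step: "edge_path w a p x \<Longrightarrow> adjacent w x y
    \<Longrightarrow> edge_path w a (p +++ linepath (vertex_point x) (vertex_point y)) y"

inductive simplicial_path :: "('v::finite \<Rightarrow> 'v \<Rightarrow> real) \<Rightarrow> 'v \<Rightarrow> (real \<Rightarrow> 'v complex_space)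
    \<Rightarrow> 'v + 'v set set \<Rightarrow> bool"
  for w a where
  simplicial_path_refl: "simplicial_path w a (linepath (pt (Inl a)) (pt (Inl a))) (Inl a)"
| simplicial_path_step: "simplicial_path w a p s \<Longrightarrow> \<sigma> \<in> simplices w \<Longrightarrow> s \<in> \<sigma> \<Longrightarrow> t \<in> \<sigma>
    \<Longrightarrow> simplicial_path w a (p +++ linepath (pt s) (pt t)) t"

lemma homotopic_paths_trivial_end:
  "path p \<Longrightarrow> path_image p \<subseteq> X \<Longrightarrow> x = pathfinish p \<Longrightarrow> y = pathfinish p
    \<Longrightarrow> homotopic_paths X (p +++ linepath x y) p"
  by (simp add: homotopic_paths_rid)

lemma simplex_linepath:
  assumes "\<sigma> \<in> simplices w" "p \<in> realisation \<sigma>" "q \<in> realisation \<sigma>"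
  shows "path_image (linepath p q) \<subseteq> realisation \<sigma>" "path_image (linepath p q) \<subseteq> graph_complex w"
proof -
  show 1: "path_image (linepath p q) \<subseteq> realisation \<sigma>"
    unfolding path_image_linepath using assms by (intro closed_segment_subset) auto
  show "path_image (linepath p q) \<subseteq> graph_complex w"
    using 1 realisation_subset[OF assms(1)] by (rule order_trans)
qed

lemma edge_simplex': "adjacent w x y \<Longrightarrow> {Inl x, Inl y} \<in> simplices w"
  using edge_simplex[of "{x, y}" w] by (auto simp: graph_edges_def)

lemma edge_linepath:
  assumes "adjacent w x y"
  shows "path_image (linepath (vertex_point x) (vertex_point y)) \<subseteq> graph_complex w"
  unfolding vertex_point_eq using assms
  by (intro simplex_linepath(2)[OF edge_simplex'] pt_in_realisation) auto

lemma edge_path_basic: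
  assumes "edge_path w a p x"
  shows "path p \<and> path_image p \<subseteq> graph_complex w \<and> pathstart p = vertex_point a \<and> pathfinish p = vertex_point x"
  using assms
proof induction
  case edge_path_refl
  then show ?case using vertex_in_complex by (simp add: vertex_point_eq del: linepath_trivial)
next
  case (edge_path_step p x y)
  then show ?case using edge_linepath[of w x y] by (simp add: subset_path_image_join)
qed

lemma simplicial_path_basic:
  assumes "simplicial_path w a p s"
  shows "path p \<and> path_image p \<subseteq> graph_complex w \<and> pathstart p = pt (Inl a) \<and> pathfinish p = pt s"
  using assms
proof induction
  case simplicial_path_refl
  then show ?case using vertex_in_complex by (simp del: linepath_trivial)
next
  case (simplicial_path_step p s \<sigma> t)
  then show ?case
    using simplex_linepath(2)[OF simplicial_path_step(2), of "pt s" "pt t"]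
    by (simp add: subset_path_image_join pt_in_realisation)
qed

lemma triangle_homotopic:
  assumes "\<sigma> \<in> simplices w" "p \<in> realisation \<sigma>" "q \<in> realisation \<sigma>" "r \<in> realisation \<sigma>"
  shows "homotopic_paths (graph_complex w) (linepath p q +++ linepath q r) (linepath p r)"
  using assms
  by (intro simplex_homotopic_paths[OF assms(1)] subset_path_image_join simplex_linepath(1)[OF assms(1)]) auto

text \<open>Apexes can be avoided. A path arriving at the apex of \<open>C\<close> is homotopic, for each vertex \<open>x\<close> of the
polygon, to an edge path to \<open>x\<close> followed by the segment from \<open>x\<close> to the apex: this holds for one \<open>x\<close>, and the
triangles of the disk spread it around the polygon. Choosing for \<open>x\<close> the vertex at which the path
leaves the apex cancels the detour.\<close>

lemma simplicial_path_homotopic_edge_path: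
  assumes "mwg w m" and "simplicial_path w a p s"
  shows "(\<forall>x. s = Inl x \<longrightarrow> (\<exists>q. edge_path w a q x \<and> homotopic_paths (graph_complex w) p q))
       \<and> (\<forall>C. s = Inr C \<longrightarrow> C \<in> short_cycles w \<longrightarrow> (\<forall>x\<in>\<Union>C. \<exists>q. edge_path w a q x \<and>
            homotopic_paths (graph_complex w) p (q +++ linepath (pt (Inl x)) (pt (Inr C)))))"
  using assms(2)
proof induction
  case simplicial_path_refl
  have "edge_path w a (linepath (pt (Inl a)) (pt (Inl a))) a"
    using edge_path_refl[of w a] by (simp add: vertex_point_eq)
  moreover have "homotopic_paths (graph_complex w) (linepath (pt (Inl a)) (pt (Inl a))) (linepath (pt (Inl a)) (pt (Inl a)))"
    using vertex_in_complex by simp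
  ultimately show ?case by (auto simp del: linepath_trivial)
next
  case (simplicial_path_step p s \<sigma> t)
  let ?X = "graph_complex w"
  let ?l = "linepath (pt s) (pt t)"
  note st = simplicial_path_step(2-4)
  note p = simplicial_path_basic[OF simplicial_path_step(1)]
  have l: "path_image ?l \<subseteq> ?X"
    using st by (intro simplex_linepath(2) pt_in_realisation)
  show ?case
  proof (cases s)
    case s: (Inl x)
    then obtain q where q: "edge_path w a q x" "homotopic_paths ?X p q"
      using simplicial_path_step.IH by blast
    note q' = edge_path_basic[OF q(1)]
    have pq: "homotopic_paths ?X (p +++ ?l) (q +++ ?l)"
      using p q l s by (intro homotopic_paths_join) auto
    show ?thesis
    proof (cases t)
      case t: (Inl y)
      have "\<exists>q. edge_path w a q y \<and> homotopic_paths ?X (p +++ ?l) q"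
      proof (cases "x = y")
        case True
        have "homotopic_paths ?X (q +++ ?l) q"
          using q' s t True by (intro homotopic_paths_trivial_end) (auto simp: vertex_point_eq)
        with q(1) True homotopic_paths_trans[OF pq] show ?thesis by blast
      next
        case False
        have "\<exists>e\<in>graph_edges w. x \<in> e \<and> y \<in> e"
          using st(1)
        proof (cases rule: simplices_cases)
          case (3 C e)
          then show ?thesis using short_cycle_edges[OF 3(1,2)] st s t by auto
        qed (use st s t False in auto)
        then have adj: "adjacent w x y"
          using False mwg.weight_sym[OF assms(1)] by (auto simp: graph_edges_def adjacent_def)
        then show ?thesis
          using edge_path_step[OF q(1) adj] pq s t by (auto simp: vertex_point_eq)
      qed
      then show ?thesis using t by auto
    next
      case t: (Inr C)
      have "\<exists>q. edge_path w a q y \<and> homotopic_paths ?X (p +++ ?l) (q +++ linepath (pt (Inl y)) (pt (Inr C)))"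
        if C: "C \<in> short_cycles w" and y: "y \<in> \<Union>C" for y
      proof (rule short_cycle_induct[OF C _ _ y])
        show "x \<in> \<Union>C"
          using st(1)
        proof (cases rule: simplices_cases)
          case (3 C e)
          then show ?thesis using st s t by auto
        qed (use st s t in auto)
        show "\<exists>q. edge_path w a q x \<and> homotopic_paths ?X (p +++ ?l) (q +++ linepath (pt (Inl x)) (pt (Inr C)))"
          using q(1) pq s t by auto
      next
        fix y z
        assume yz: "{y, z} \<in> C"
          and "\<exists>q. edge_path w a q y \<and> homotopic_paths ?X (p +++ ?l) (q +++ linepath (pt (Inl y)) (pt (Inr C)))"
        then obtain q where q: "edge_path w a q y"
          and h: "homotopic_paths ?X (p +++ ?l) (q +++ linepath (pt (Inl y)) (pt (Inr C)))" by blast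
        note q' = edge_path_basic[OF q]
        have adj: "adjacent w y z"
          using short_cycle_edges[OF C yz] mwg.weight_sym[OF assms(1)] by (auto simp: graph_edges_def adjacent_def doubleton_eq_iff)
        let ?yz = "linepath (pt (Inl y)) (pt (Inl z))"
        let ?zC = "linepath (pt (Inl z)) (pt (Inr C))"
        have \<tau>: "insert (Inr C) (Inl ` {y, z}) \<in> simplices w" by (rule cone_simplex[OF C yz])
        have sub: "path_image ?yz \<subseteq> ?X" "path_image ?zC \<subseteq> ?X"
          by (intro simplex_linepath(2)[OF \<tau>] pt_in_realisation; simp)+
        have "homotopic_paths ?X (linepath (pt (Inl y)) (pt (Inr C))) (?yz +++ ?zC)"
          by (rule homotopic_paths_sym, rule triangle_homotopic[OF \<tau>]) (auto intro: hull_inc)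
        then have "homotopic_paths ?X (q +++ linepath (pt (Inl y)) (pt (Inr C))) (q +++ (?yz +++ ?zC))"
          using q' by (intro homotopic_paths_join) (auto simp: vertex_point_eq)
        also have "homotopic_paths ?X \<dots> ((q +++ ?yz) +++ ?zC)"
          using q' sub by (intro homotopic_paths_assoc) (auto simp: vertex_point_eq)
        finally have "homotopic_paths ?X (p +++ ?l) ((q +++ ?yz) +++ ?zC)"
          using homotopic_paths_trans[OF h] by blast
        then show "\<exists>q. edge_path w a q z \<and> homotopic_paths ?X (p +++ ?l) (q +++ ?zC)"
          using edge_path_step[OF q adj] by (auto simp: vertex_point_eq)
      qed
      then show ?thesis using t by auto
    qed
  next
    case s: (Inr C)
    have C: "C \<in> short_cycles w"
      using st(1)
    proof (cases rule: simplices_cases)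
      case (3 C e)
      then show ?thesis using st s by auto
    qed (use st s in auto)
    have IH: "\<exists>q. edge_path w a q x \<and> homotopic_paths ?X p (q +++ linepath (pt (Inl x)) (pt (Inr C)))"
      if "x \<in> \<Union>C" for x
      using simplicial_path_step.IH s C that by blast
    show ?thesis
    proof (cases t)
      case t: (Inl x)
      have "x \<in> \<Union>C"
        using st(1)
      proof (cases rule: simplices_cases)
        case (3 C e)
        then show ?thesis using st s t by auto
      qed (use st s t in auto)
      then obtain q where q: "edge_path w a q x"
        and h: "homotopic_paths ?X p (q +++ linepath (pt (Inl x)) (pt (Inr C)))"
        using IH by blast
      note q' = edge_path_basic[OF q]
      have "homotopic_paths ?X (linepath (pt t) (pt s) +++ ?l) (linepath (pt t) (pt t))"
        using st by (intro triangle_homotopic[OF st(1)] pt_in_realisation)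
      then have "homotopic_paths ?X (p +++ ?l) (q +++ linepath (pt t) (pt t))"
        using h q' s t by (intro homotopic_paths_replace_end[of ?X p q "linepath (pt t) (pt s)"])
          (auto simp: vertex_point_eq)
      also have "homotopic_paths ?X \<dots> q"
        using q' t by (intro homotopic_paths_trivial_end) (auto simp: vertex_point_eq)
      finally show ?thesis using q t by auto
    next
      case t: (Inr C')
      have "C' = C"
        using st(1)
      proof (cases rule: simplices_cases)
        case (3 C e)
        then show ?thesis using st s t by auto
      qed (use st s t in auto)
      then have "homotopic_paths ?X (p +++ ?l) p"
        using p s t by (intro homotopic_paths_trivial_end) auto
      then show ?thesis
        using IH t \<open>C' = C\<close> homotopic_paths_trans by blast
    qed
  qed
qed

text \<open>Simplicial approximation along a path \<open>g\<close>. Call a time \<open>t\<close> good if \<open>g\<close> up to time \<open>t\<close> is homotopic to a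
simplicial path to some vertex \<open>s\<close> whose open star contains \<open>g t\<close>, followed by the segment
from \<open>s\<close> to \<open>g t\<close>. While \<open>g\<close> stays inside one open star, goodness passes from any time to any other, so by
connectedness of the interval all times are good. At the final time \<open>g t\<close> is a vertex of the graph,
which lies in no open star but its own.\<close>

lemma path_homotopic_edge_path:
  assumes "mwg w m" "path g" "path_image g \<subseteq> graph_complex w"
    and "pathstart g = vertex_point a" "pathfinish g = vertex_point v"
  obtains q where "edge_path w a q v" "homotopic_paths (graph_complex w) g q"
proof -
  let ?X = "graph_complex w"
  define good where "good t \<longleftrightarrow> (\<exists>p s. simplicial_path w a p s \<and> g t $ s > 0 \<and>
      homotopic_paths ?X (subpath 0 t g) (p +++ linepath (pt s) (g t)))" for t
  have gX: "g t \<in> ?X" if "t \<in> {0..1}" for t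
    using assms(3) that unfolding path_image_def by blast
  have cont: "continuous_on {0..1} g" using assms(2) by (simp add: path_def)
  have "good 1"
  proof (rule connected_induction_simple[where S = "{0..1::real}" and P = good and a = 0])
    show "good 0"
    proof -
      have g0: "g 0 = pt (Inl a)" using assms(4) by (simp add: pathstart_def vertex_point_eq)
      let ?l = "linepath (pt (Inl a)) (pt (Inl a))"
      have "subpath 0 0 g = ?l" by (auto simp: subpath_def g0 linepath_def algebra_simps)
      moreover have "homotopic_paths ?X ?l (?l +++ ?l)"
        using vertex_in_complex by (intro homotopic_paths_sym[OF homotopic_paths_lid']) auto
      ultimately show ?thesis
        unfolding good_def using simplicial_path_refl[of w a] by (auto simp: g0 pt_nth)
    qed
  next
    fix t0 :: real assume t0: "t0 \<in> {0..1}"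
    obtain \<sigma>0 where "g t0 \<in> realisation \<sigma>0" by (rule graph_complex_simplex[OF gX[OF t0]])
    then obtain s where s: "g t0 $ s > 0" by (rule exists_positive_coord)
    have "continuous_on {0..1} (\<lambda>t. g t $ s)" by (intro continuous_intros cont)
    then obtain \<delta> where \<delta>: "\<delta> > 0" "\<And>t. t \<in> {0..1} \<Longrightarrow> dist t t0 < \<delta> \<Longrightarrow> dist (g t $ s) (g t0 $ s) < g t0 $ s"
      using s t0 unfolding continuous_on_iff by meson
    define T where "T = {0..1} \<inter> ball t0 \<delta>"
    have Ts: "g t $ s > 0" if "t \<in> T" for t
      using \<delta>(2)[of t] that by (auto simp: T_def dist_commute dist_real_def)
    have "good y" if x: "x \<in> T" and y: "y \<in> T" and "good x" for x y
    proof -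
      have xy: "x \<in> {0..1}" "y \<in> {0..1}" using x y by (auto simp: T_def)
      obtain p s' where p: "simplicial_path w a p s'" and s': "g x $ s' > 0"
        and h: "homotopic_paths ?X (subpath 0 x g) (p +++ linepath (pt s') (g x))"
        using \<open>good x\<close> unfolding good_def by blast
      note p' = simplicial_path_basic[OF p]
      obtain \<sigma> where \<sigma>: "\<sigma> \<in> simplices w" "g x \<in> realisation \<sigma>"
        and pos: "\<forall>s. g x $ s > 0 \<longrightarrow> s \<in> \<sigma>"
        by (rule graph_complex_simplex[OF gX[OF xy(1)]])
      have ss: "s \<in> \<sigma>" "s' \<in> \<sigma>" using pos s' Ts[OF x] by auto
      have gT: "g t \<in> open_star w s" if "t \<in> T" for t
        using Ts[OF that] gX[of t] that by (simp add: open_star_def T_def)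
      have "convex T" unfolding T_def by (intro convex_Int) auto
      then have seg: "closed_segment x y \<subseteq> T" using x y by (simp add: closed_segment_subset)
      have star: "path_image (subpath x y g) \<subseteq> open_star w s"
        unfolding path_image_subpath_gen using seg gT by blast
      have gy: "g y \<in> open_star w s" by (rule gT[OF y])
      have sub: "path (subpath x y g)" using assms(2) xy by simp
      let ?l = "linepath (pt s') (g x)" and ?m = "linepath (pt s') (pt s)" and ?k = "linepath (pt s) (g y)"
      have lin: "path_image ?l \<subseteq> realisation \<sigma>" "path_image ?m \<subseteq> realisation \<sigma>"
        using \<sigma> ss by (intro simplex_linepath(1) pt_in_realisation; simp)+
      have k: "path_image ?k \<subseteq> open_star w s"
        using open_star_segment[OF gy] by simp
      have starX: "open_star w s \<subseteq> ?X" by (auto simp: open_star_def)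
      \<comment> \<open>A closed simplex with vertex \<open>s\<close> together with the open star of \<open>s\<close> is star-shaped about \<open>s\<close>, so
        the carrier of \<open>g x\<close> can be changed from \<open>s'\<close> to \<open>s\<close> while \<open>g\<close> is followed from \<open>x\<close> to \<open>y\<close>.\<close>
      have "homotopic_paths ?X (?l +++ subpath x y g) (?m +++ ?k)"
      proof (rule starlike_homotopic_paths)
        show "pt s \<in> realisation \<sigma> \<union> open_star w s" using pt_in_realisation[OF ss(1)] by blast
        show "closed_segment (pt s) z \<subseteq> realisation \<sigma> \<union> open_star w s"
          if "z \<in> realisation \<sigma> \<union> open_star w s" for z
          using that
        proof
          assume "z \<in> realisation \<sigma>"
          then have "closed_segment (pt s) z \<subseteq> realisation \<sigma>"
            using pt_in_realisation[OF ss(1)] by (intro closed_segment_subset) auto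
          then show ?thesis by blast
        next
          assume "z \<in> open_star w s"
          then show ?thesis using open_star_segment by blast
        qed
        show "realisation \<sigma> \<union> open_star w s \<subseteq> ?X"
          using realisation_subset[OF \<sigma>(1)] starX by blast
        show "path_image (?l +++ subpath x y g) \<subseteq> realisation \<sigma> \<union> open_star w s"
          using lin star by (intro subset_path_image_join) auto
        show "path_image (?m +++ ?k) \<subseteq> realisation \<sigma> \<union> open_star w s"
          using lin k by (intro subset_path_image_join) auto
      qed (use sub in auto)
      with h have "homotopic_paths ?X (subpath 0 x g +++ subpath x y g) (p +++ (?m +++ ?k))"
        by (rule homotopic_paths_replace_end) (use p' in auto)
      moreover have "homotopic_paths ?X (subpath 0 y g) (subpath 0 x g +++ subpath x y g)"
        using assms xy by (intro homotopic_paths_sym[OF homotopic_join_subpaths]) auto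
      moreover have "homotopic_paths ?X (p +++ (?m +++ ?k)) ((p +++ ?m) +++ ?k)"
        using p' lin k starX realisation_subset[OF \<sigma>(1)] by (intro homotopic_paths_assoc) auto
      ultimately have "homotopic_paths ?X (subpath 0 y g) ((p +++ ?m) +++ ?k)"
        using homotopic_paths_trans by blast
      moreover have "simplicial_path w a (p +++ ?m) s"
        using p \<sigma>(1) ss by (intro simplicial_path_step)
      ultimately show "good y"
        unfolding good_def using Ts[OF y] by blast
    qed
    moreover have "openin (top_of_set {0..1}) T" "t0 \<in> T"
      unfolding T_def using t0 \<delta>(1) by (auto intro: openin_open_Int)
    ultimately show "\<exists>T. openin (top_of_set {0..1}) T \<and> t0 \<in> T \<and> (\<forall>x\<in>T. \<forall>y\<in>T. good x \<longrightarrow> good y)"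
      by blast
  qed auto
  then obtain p s where p: "simplicial_path w a p s" and s: "g 1 $ s > 0"
    and h: "homotopic_paths ?X (subpath 0 1 g) (p +++ linepath (pt s) (g 1))"
    unfolding good_def by blast
  note p' = simplicial_path_basic[OF p]
  have g1: "g 1 = pt (Inl v)" using assms(5) by (simp add: pathfinish_def vertex_point_eq)
  then have sv: "s = Inl v" using s by (simp add: pt_nth split: if_splits)
  have "homotopic_paths ?X (p +++ linepath (pt s) (g 1)) p"
    using p' g1 sv by (intro homotopic_paths_trivial_end) auto
  moreover obtain q where "edge_path w a q v" "homotopic_paths ?X p q"
    using simplicial_path_homotopic_edge_path[OF assms(1) p] sv by blast
  ultimately show ?thesis
    using that h homotopic_paths_trans by (metis subpath_trivial)
qed

section \<open>The cover by homotopy classes of edge paths\<close>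

lemma path_class_cong: "homotopic_paths X p q \<Longrightarrow> path_class X p = path_class X q"
  unfolding path_class_def
  using homotopic_paths_trans[of X p q] homotopic_paths_trans[of X q p] homotopic_paths_sym[of X p q] by blast

text \<open>Appending a path is well defined on homotopy classes; the union only removes the choice of a
representative.\<close>

lemma path_class_append:
  assumes "path p" "path_image p \<subseteq> X" "path l" "path_image l \<subseteq> X" "pathfinish p = pathstart l"
  shows "(\<Union>q\<in>path_class X p. path_class X (q +++ l)) = path_class X (p +++ l)"
proof -
  have "path_class X (q +++ l) = path_class X (p +++ l)" if "q \<in> path_class X p" for q
    using that assms unfolding path_class_def[of X p]
    by (intro path_class_cong homotopic_paths_join)
       (auto simp: homotopic_paths_sym dest: homotopic_paths_imp_pathfinish)
  moreover have "p \<in> path_class X p" using assms by (simp add: path_class_def)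
  ultimately show ?thesis by blast
qed

lemma filled_polygon_linepath:
  assumes "{x, y} \<in> C"
  shows "path_image (linepath (vertex_point x) (vertex_point y)) \<subseteq> filled_polygon C"
proof -
  have "closed_segment (vertex_point x) (vertex_point y) \<subseteq> realisation (insert (Inr C) (Inl ` {x, y}))"
    by (intro closed_segment_subset) (auto simp: vertex_point_eq hull_inc)
  then show ?thesis using assms unfolding filled_polygon_eq path_image_linepath by blast
qed

lemma triangle_cycle:
  assumes "distinct [x, y, z]" "adjacent w x y" "adjacent w y z" "adjacent w z x"
  shows "\<exists>C\<in>short_cycles w. {x, y} \<in> C \<and> {y, z} \<in> C \<and> {z, x} \<in> C"
proof (intro bexI conjI)
  show "cycle_edges [x, y, z] \<in> short_cycles w"
    unfolding short_cycles_def using assms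
    by (intro CollectI exI[of _ "[x, y, z]"]) (simp add: graph_cycle_def All_less_Suc)
  show "{x, y} \<in> cycle_edges [x, y, z]"
    unfolding cycle_edges_def by (intro CollectI exI[of _ 0]) simp
  show "{y, z} \<in> cycle_edges [x, y, z]"
    unfolding cycle_edges_def by (intro CollectI exI[of _ 1]) simp
  show "{z, x} \<in> cycle_edges [x, y, z]"
    unfolding cycle_edges_def by (intro CollectI exI[of _ 2]) simp
qed

lemma square_cycle:
  assumes "distinct [x, y, z, u]" "adjacent w x y" "adjacent w y z" "adjacent w z u" "adjacent w u x"
  shows "\<exists>C\<in>short_cycles w. {x, y} \<in> C \<and> {y, z} \<in> C \<and> {z, u} \<in> C \<and> {u, x} \<in> C"
proof (intro bexI conjI)
  show "cycle_edges [x, y, z, u] \<in> short_cycles w"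
    unfolding short_cycles_def using assms
    by (intro CollectI exI[of _ "[x, y, z, u]"]) (simp add: graph_cycle_def All_less_Suc)
  show "{x, y} \<in> cycle_edges [x, y, z, u]"
    unfolding cycle_edges_def by (intro CollectI exI[of _ 0]) simp
  show "{y, z} \<in> cycle_edges [x, y, z, u]"
    unfolding cycle_edges_def by (intro CollectI exI[of _ 1]) simp
  show "{z, u} \<in> cycle_edges [x, y, z, u]"
    unfolding cycle_edges_def by (intro CollectI exI[of _ 2]) simp
  show "{u, x} \<in> cycle_edges [x, y, z, u]"
    unfolding cycle_edges_def by (intro CollectI exI[of _ 3]) simp
qed

text \<open>This is the vertex set of the universal cover in its usual construction: homotopy classes of
edge paths from the base vertex \<open>a\<close>. The end vertex is stored with the class, so that \<open>snd\<close> is the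
projection to the base graph.\<close>

definition edge_path_classes ::
  "('v::finite \<Rightarrow> 'v \<Rightarrow> real) \<Rightarrow> 'v \<Rightarrow> ((real \<Rightarrow> 'v complex_space) set \<times> 'v) set" where
  "edge_path_classes w a = {(path_class (graph_complex w) p, x) | p x. edge_path w a p x}"

definition extend_class ::
  "('v::finite \<Rightarrow> 'v \<Rightarrow> real) \<Rightarrow> (real \<Rightarrow> 'v complex_space) set \<times> 'v \<Rightarrow> 'v
     \<Rightarrow> (real \<Rightarrow> 'v complex_space) set \<times> 'v" where
  "extend_class w c y =
     (\<Union>p\<in>fst c. path_class (graph_complex w) (p +++ linepath (vertex_point (snd c)) (vertex_point y)), y)"

lemma extend_class_eq:
  assumes "edge_path w a p x" "adjacent w x y"
  shows "extend_class w (path_class (graph_complex w) p, x) y =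
    (path_class (graph_complex w) (p +++ linepath (vertex_point x) (vertex_point y)), y)"
  unfolding extend_class_def
  using edge_path_basic[OF assms(1)] edge_linepath[OF assms(2)]
  by (simp add: path_class_append)

text \<open>Going along an edge and back is null-homotopic, and the filled disks make closed walks around triangles and
squares null-homotopic; these are the axioms of a graph cover.\<close>

lemma graph_cover_edge_path_classes:
  assumes "mwg w m"
  shows "graph_cover w m (edge_path_classes w a) snd (extend_class w)
     (path_class (graph_complex w) (linepath (vertex_point a) (vertex_point a)), a)"
proof -
  interpret mwg w m by fact
  let ?X = "graph_complex w"
  let ?l = "\<lambda>x y. linepath (vertex_point x) (vertex_point y)"
  have sym: "adjacent w x y \<Longrightarrow> adjacent w y x" for x y by (simp add: adjacent_def weight_sym)
  have neq: "adjacent w x y \<Longrightarrow> x \<noteq> y" for x y by (auto simp: adjacent_def weight_diag)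
  have ext: "extend_class w (path_class ?X p, x) y = (path_class ?X (p +++ ?l x y), y)"
    and ext2: "adjacent w y z \<Longrightarrow> extend_class w (path_class ?X (p +++ ?l x y), y) z
        = (path_class ?X ((p +++ ?l x y) +++ ?l y z), z)"
    if "edge_path w a p x" "adjacent w x y" for p x y z
    using extend_class_eq[OF that] extend_class_eq[OF edge_path_step[OF that]] by auto
  have two: "homotopic_paths ?X ((p +++ ?l x y) +++ ?l y z) (p +++ k)"
    if p: "edge_path w a p x" and "adjacent w x y" and k: "homotopic_paths ?X (?l x y +++ ?l y z) k"
    for p x y z k
  proof (rule homotopic_paths_replace_end[OF _ k])
    show "homotopic_paths ?X (p +++ ?l x y) (p +++ ?l x y)"
      using edge_path_basic[OF edge_path_step[OF that(1,2)]] by simp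
  qed (use edge_path_basic[OF p] in auto)
  show ?thesis
  proof
    show "(path_class ?X (?l a a), a) \<in> edge_path_classes w a"
      unfolding edge_path_classes_def using edge_path_refl by blast
  next
    fix c y assume "c \<in> edge_path_classes w a" and y: "adjacent w (snd c) y"
    then obtain p x where p: "edge_path w a p x" "c = (path_class ?X p, x)"
      by (auto simp: edge_path_classes_def)
    have xy: "adjacent w x y" using y p by simp
    have e: "extend_class w c y = (path_class ?X (p +++ ?l x y), y)" using ext[OF p(1) xy] p(2) by simp
    show "extend_class w c y \<in> edge_path_classes w a"
      unfolding e edge_path_classes_def using edge_path_step[OF p(1) xy] by blast
    show "snd (extend_class w c y) = y" by (simp add: e)
    have "homotopic_paths ?X (?l x y +++ ?l y x) (?l x x)"
      unfolding vertex_point_eq by (rule triangle_homotopic[OF edge_simplex'[OF xy]]) (auto intro: hull_inc)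
    from two[OF p(1) xy this] have "homotopic_paths ?X ((p +++ ?l x y) +++ ?l y x) (p +++ ?l x x)" .
    also have "homotopic_paths ?X \<dots> p"
      using edge_path_basic[OF p(1)] by (intro homotopic_paths_trivial_end) auto
    finally show "extend_class w (extend_class w c y) (snd c) = c"
      unfolding e using ext2[OF p(1) xy sym[OF xy]] p(2) by (simp add: path_class_cong)
    fix z assume yz: "adjacent w y z"
    have e2: "extend_class w (extend_class w c y) z = (path_class ?X ((p +++ ?l x y) +++ ?l y z), z)"
      using ext2[OF p(1) xy yz] e by simp
    { assume "adjacent w (snd c) z"
      then have xz: "adjacent w x z" using p by simp
      have "distinct [x, y, z]" using xy yz xz neq by auto
      then obtain C where C: "C \<in> short_cycles w" "{x, y} \<in> C" "{y, z} \<in> C" "{z, x} \<in> C"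
        using triangle_cycle[OF _ xy yz sym[OF xz]] by blast
      then have "{x, z} \<in> C" by (simp add: insert_commute)
      then have "homotopic_paths ?X (?l x y +++ ?l y z) (?l x z)"
        using C by (intro filled_polygon_homotopic_paths[OF C(1)] subset_path_image_join filled_polygon_linepath) auto
      from path_class_cong[OF two[OF p(1) xy this]]
      show "extend_class w (extend_class w c y) z = extend_class w c z"
        unfolding e2 using ext[OF p(1) xz] p(2) by simp }
    { fix y' assume "adjacent w (snd c) y'" and y'z: "adjacent w y' z" and "z \<noteq> snd c" "y \<noteq> y'"
      then have xy': "adjacent w x y'" using p by simp
      have "distinct [x, y, z, y']"
        using xy yz xy' y'z neq \<open>z \<noteq> snd c\<close> \<open>y \<noteq> y'\<close> p(2) by auto
      then obtain C where C: "C \<in> short_cycles w" "{x, y} \<in> C" "{y, z} \<in> C" "{z, y'} \<in> C" "{y', x} \<in> C"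
        using square_cycle[OF _ xy yz sym[OF y'z] sym[OF xy']] by blast
      then have C': "{x, y'} \<in> C" "{y', z} \<in> C" by (simp_all add: insert_commute)
      have h: "homotopic_paths ?X (?l x y +++ ?l y z) (?l x y' +++ ?l y' z)"
        using C C' by (intro filled_polygon_homotopic_paths[OF C(1)] subset_path_image_join filled_polygon_linepath) auto
      have h': "homotopic_paths ?X (?l x y' +++ ?l y' z) (?l x y' +++ ?l y' z)"
        using h homotopic_paths_sym homotopic_paths_trans by blast
      have "path_class ?X ((p +++ ?l x y) +++ ?l y z) = path_class ?X ((p +++ ?l x y') +++ ?l y' z)"
        using path_class_cong[OF two[OF p(1) xy h]] path_class_cong[OF two[OF p(1) xy' h']] by simp
      then show "extend_class w (extend_class w c y) z = extend_class w (extend_class w c y') z"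
        unfolding e2 using ext[OF p(1) xy'] ext2[OF p(1) xy' y'z] p(2) by simp }
  next
    fix c assume "c \<in> edge_path_classes w a"
    then obtain p x where "edge_path w a p x" "c = (path_class ?X p, x)"
      by (auto simp: edge_path_classes_def)
    then show "(\<lambda>c c'. \<exists>y. adjacent w (snd c) y \<and> c' = extend_class w c y)\<^sup>*\<^sup>*
        (path_class ?X (?l a a), a) c"
    proof (induction arbitrary: c)
      case edge_path_refl
      then show ?case by (simp del: linepath_trivial)
    next
      case (edge_path_step p x y)
      have "\<exists>z. adjacent w (snd (path_class ?X p, x)) z \<and> c = extend_class w (path_class ?X p, x) z"
        using ext[OF edge_path_step(1,2)] edge_path_step(2,4) by auto
      with edge_path_step(3)[OF refl] show ?case by (rule rtranclp.rtrancl_into_rtrancl)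
    qed
  qed
qed

lemma finite_edge_path_classes:
  assumes "mwg w m" "spectrally_positive w m"
  shows "finite (edge_path_classes w a)"
proof -
  interpret graph_cover w m "edge_path_classes w a" snd "extend_class w"
     "(path_class (graph_complex w) (linepath (vertex_point a) (vertex_point a)), a)"
    by (rule graph_cover_edge_path_classes) fact
  obtain K n \<rho> where K: "K > 0" and n: "n > 0" and CD: "curvature_dimension w m \<rho> n"
    and spec: "\<forall>f. 1/2 * inner_m m (\<lambda>x. - laplacian w m f x) f + inner_m m (\<lambda>x. \<rho> x * f x) f
              \<ge> K * inner_m m f f"
    using assms(2) unfolding spectrally_positive_def by blast
  obtain \<phi> where "\<And>x. \<phi> x > 0" "\<And>x. laplacian w m \<phi> x - 2 * \<rho> x * \<phi> x = -2"
    using positive_supersolution[OF assms(1) K spec[rule_format]] by blast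
  then show ?thesis using finite_cover[OF CD n] by blast
qed


section \<open>The fundamental group and the cells of the universal cover\<close>

text \<open>Join \<open>c\<close> by a segment \<open>\<gamma>\<close> to a vertex of a simplex containing it. Conjugation with \<open>\<gamma>\<close> turns
loops at \<open>c\<close> into loops at this vertex, which are homotopic to edge paths, and there are only finitely many
classes of those.\<close>

lemma finite_fundamental_group:
  assumes "mwg w m" "spectrally_positive w m" and c: "c \<in> graph_complex w"
  shows "finite (carrier (fundamental_group (graph_complex w) c))"
proof -
  let ?X = "graph_complex w"
  obtain \<sigma> where \<sigma>: "\<sigma> \<in> simplices w" "c \<in> realisation \<sigma>"
    by (rule graph_complex_simplex[OF c])
  have "\<exists>v. Inl v \<in> \<sigma>"
    using \<sigma>(1)
  proof (cases rule: simplices_cases)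
    case (3 C e)
    then show ?thesis using short_cycle_edges[OF 3(1,2)] by (auto simp: graph_edges_def)
  qed (auto simp: graph_edges_def)
  then obtain a where a: "Inl a \<in> \<sigma>" by blast
  define \<gamma> where "\<gamma> = linepath (vertex_point a) c"
  have \<gamma>: "path \<gamma>" "path_image \<gamma> \<subseteq> ?X" "pathstart \<gamma> = vertex_point a" "pathfinish \<gamma> = c"
    using simplex_linepath(2)[OF \<sigma>(1) pt_in_realisation[OF a] \<sigma>(2)]
    by (auto simp: \<gamma>_def vertex_point_eq)
  let ?r = "reversepath \<gamma>"
  define conjugate where "conjugate Q = (\<Union>q\<in>Q. path_class ?X (?r +++ (q +++ \<gamma>)))" for Q
  have "path_class ?X p \<in> (conjugate \<circ> fst) ` edge_path_classes w a" if "p \<in> loops_at ?X c" for p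
  proof -
    have p: "path p" "path_image p \<subseteq> ?X" "pathstart p = c" "pathfinish p = c"
      using that by (auto simp: loops_at_def)
    obtain q where q: "edge_path w a q a" and h: "homotopic_paths ?X (\<gamma> +++ (p +++ ?r)) q"
      using path_homotopic_edge_path[OF assms(1), of "\<gamma> +++ (p +++ ?r)" a a] \<gamma> p
      by (auto simp: subset_path_image_join)
    note q' = edge_path_basic[OF q]
    have "homotopic_paths ?X (q +++ \<gamma>) (\<gamma> +++ ((p +++ ?r) +++ \<gamma>))"
    proof (rule homotopic_paths_replace_end[where l = "p +++ ?r"])
      show "homotopic_paths ?X ((p +++ ?r) +++ \<gamma>) ((p +++ ?r) +++ \<gamma>)"
        using p \<gamma> by (simp add: subset_path_image_join)
    qed (use h p \<gamma> in \<open>auto simp: homotopic_paths_sym\<close>)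
    moreover have "homotopic_paths ?X ((p +++ ?r) +++ \<gamma>) p"
    proof -
      have "homotopic_paths ?X ((p +++ ?r) +++ \<gamma>) (p +++ linepath c c)"
      proof (rule homotopic_paths_replace_end[where l = ?r])
        show "homotopic_paths ?X (p +++ ?r) (p +++ ?r)"
          using p \<gamma> by (simp add: subset_path_image_join)
        show "homotopic_paths ?X (?r +++ \<gamma>) (linepath c c)"
          using homotopic_paths_linv[of \<gamma> ?X] \<gamma> by simp
      qed (use p \<gamma> in auto)
      also have "homotopic_paths ?X \<dots> p"
        using p by (intro homotopic_paths_trivial_end) auto
      finally show ?thesis .
    qed
    then have "homotopic_paths ?X (\<gamma> +++ ((p +++ ?r) +++ \<gamma>)) (\<gamma> +++ p)"
      using p \<gamma> by (intro homotopic_paths_join) auto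
    ultimately have "homotopic_paths ?X (q +++ \<gamma>) (\<gamma> +++ p)" by (rule homotopic_paths_trans)
    then have "homotopic_paths ?X (?r +++ (q +++ \<gamma>)) (?r +++ (\<gamma> +++ p))"
      by (rule homotopic_paths_join[rotated]) (use \<gamma> q' in auto)
    also have "homotopic_paths ?X \<dots> ((?r +++ \<gamma>) +++ p)"
      using p \<gamma> by (intro homotopic_paths_assoc) auto
    also have "homotopic_paths ?X \<dots> (linepath c c +++ p)"
      using homotopic_paths_linv[of \<gamma> ?X] p \<gamma> by (intro homotopic_paths_join) auto
    also have "homotopic_paths ?X \<dots> p"
      using p by (intro homotopic_paths_lid') auto
    finally have main: "homotopic_paths ?X (?r +++ (q +++ \<gamma>)) p" .
    have "path_class ?X (?r +++ (q' +++ \<gamma>)) = path_class ?X p" if "q' \<in> path_class ?X q" for q'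
    proof -
      have h: "homotopic_paths ?X q' q" using that by (simp add: path_class_def homotopic_paths_sym)
      have f: "pathfinish q' = vertex_point a" "pathstart q' = vertex_point a"
        using homotopic_paths_imp_pathfinish[OF h] homotopic_paths_imp_pathstart[OF h] q' by auto
      have "homotopic_paths ?X (q' +++ \<gamma>) (q +++ \<gamma>)"
        by (rule homotopic_paths_join) (use h f \<gamma> in auto)
      then have "homotopic_paths ?X (?r +++ (q' +++ \<gamma>)) (?r +++ (q +++ \<gamma>))"
        by (rule homotopic_paths_join[rotated]) (use f \<gamma> in auto)
      then show ?thesis using main homotopic_paths_trans path_class_cong by blast
    qed
    moreover have "q \<in> path_class ?X q" using q' by (simp add: path_class_def)
    ultimately have "conjugate (path_class ?X q) = path_class ?X p" unfolding conjugate_def by blast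
    moreover have "(path_class ?X q, a) \<in> edge_path_classes w a"
      unfolding edge_path_classes_def using q by blast
    ultimately show ?thesis by force
  qed
  then have "carrier (fundamental_group ?X c) \<subseteq> (conjugate \<circ> fst) ` edge_path_classes w a"
    by (auto simp: fundamental_group_def)
  then show ?thesis
    by (rule finite_subset) (intro finite_imageI finite_edge_path_classes[OF assms(1,2)])
qed

text \<open>Monodromy: fix a point \<open>u0\<close> of the fibre and join it to each point \<open>u\<close> of the fibre by a path in \<open>U\<close>. If
the projected loops for two points are homotopic, their lifts from \<open>u0\<close> have the same end.\<close>

lemma finite_fibre:
  fixes p :: "'c::real_normed_vector \<Rightarrow> 'b::real_normed_vector"
  assumes cov: "covering_space U p X" and "path_connected U"
    and fin: "finite (carrier (fundamental_group X a))"
  shows "finite (U \<inter> p -` {a})"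
proof (cases "U \<inter> p -` {a} = {}")
  case False
  then obtain u0 where u0: "u0 \<in> U" "p u0 = a" by blast
  have "\<forall>u\<in>U. \<exists>g. path g \<and> path_image g \<subseteq> U \<and> pathstart g = u0 \<and> pathfinish g = u"
    using \<open>path_connected U\<close> u0 unfolding path_connected_def by blast
  then obtain g where g: "\<And>u. u \<in> U \<Longrightarrow> path (g u) \<and> path_image (g u) \<subseteq> U \<and> pathstart (g u) = u0 \<and> pathfinish (g u) = u"
    by metis
  have pU: "p ` U = X" using covering_space_imp_surjective[OF cov] .
  have pg: "path (p \<circ> g u) \<and> path_image (p \<circ> g u) \<subseteq> X" if "u \<in> U" for u
  proof
    show "path (p \<circ> g u)"
      using g[OF that] covering_space_imp_continuous[OF cov] continuous_on_subset
      by (intro path_continuous_image) blast+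
    show "path_image (p \<circ> g u) \<subseteq> X"
      unfolding path_image_compose using g[OF that] pU by blast
  qed
  have loop: "p \<circ> g u \<in> loops_at X a" if "u \<in> U \<inter> p -` {a}" for u
    using pg[of u] g[of u] that u0 by (auto simp: loops_at_def pathstart_compose pathfinish_compose)
  have "inj_on (\<lambda>u. path_class X (p \<circ> g u)) (U \<inter> p -` {a})"
  proof (rule inj_onI)
    fix u v assume u: "u \<in> U \<inter> p -` {a}" and v: "v \<in> U \<inter> p -` {a}"
      and "path_class X (p \<circ> g u) = path_class X (p \<circ> g v)"
    then have h: "homotopic_paths X (p \<circ> g u) (p \<circ> g v)"
      using path_class_eq_iff[OF loop[OF u] loop[OF v]] by simp
    have U: "u \<in> U" "v \<in> U" using u v by auto
    have "pathfinish (g u) = pathfinish (g v)"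
      by (rule covering_space_monodromy[OF cov _ _ _ _ h]) (use pg U g in auto)
    then show "u = v" using g U by auto
  qed
  moreover have "(\<lambda>u. path_class X (p \<circ> g u)) ` (U \<inter> p -` {a}) \<subseteq> carrier (fundamental_group X a)"
    using loop by (auto simp: fundamental_group_def)
  ultimately show ?thesis using fin inj_on_finite by blast
qed simp

text \<open>Lifting a path in \<open>e\<close> that ends at a fixed point of \<open>e\<close> shows that every component over \<open>e\<close> meets the fibre
of that point.\<close>

lemma finite_components_over_cell:
  fixes p :: "'c::real_normed_vector \<Rightarrow> 'b::real_normed_vector"
  assumes cov: "covering_space U p X" and e: "path_connected e" "e \<subseteq> X"
    and fin: "\<And>a. a \<in> X \<Longrightarrow> finite (U \<inter> p -` {a})"
  shows "finite (components (U \<inter> p -` e))"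
proof (cases "e = {}")
  case False
  then obtain a where a: "a \<in> e" by blast
  let ?W = "U \<inter> p -` e"
  have "components ?W \<subseteq> connected_component_set ?W ` (U \<inter> p -` {a})"
  proof
    fix K assume "K \<in> components ?W"
    then obtain u where u: "u \<in> ?W" and K: "K = connected_component_set ?W u"
      unfolding components_def by blast
    obtain g where g: "path g" "path_image g \<subseteq> e" "pathstart g = p u" "pathfinish g = a"
      using e(1) u a unfolding path_connected_def by blast
    have "u \<in> U" using u by blast
    have "\<exists>h. path h \<and> path_image h \<subseteq> U \<and> pathstart h = u \<and> (\<forall>t\<in>{0..1}. p (h t) = g t)"
      by (rule covering_space_lift_path_strong[OF cov \<open>u \<in> U\<close> g(1) order_trans[OF g(2) e(2)] g(3)]) blast
    then obtain h where h: "path h" "path_image h \<subseteq> U" "pathstart h = u"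
      and ph: "\<And>t. t \<in> {0..1} \<Longrightarrow> p (h t) = g t" by blast
    have hW: "path_image h \<subseteq> ?W"
    proof
      fix z assume z: "z \<in> path_image h"
      then obtain t where t: "t \<in> {0..1}" "z = h t" unfolding path_image_def by blast
      then have "p z \<in> e" using ph[of t] g(2) unfolding path_image_def by auto
      then show "z \<in> ?W" using z h(2) by blast
    qed
    have "connected (path_image h)" using h(1) by (rule connected_path_image)
    then have "connected_component ?W u (pathfinish h)"
      using hW h(3) unfolding connected_component_def by blast
    then have "K = connected_component_set ?W (pathfinish h)"
      unfolding K using connected_component_eq by (metis mem_Collect_eq)
    moreover have "pathfinish h \<in> U \<inter> p -` {a}"
      using ph[of 1] g(4) h(2) pathfinish_in_path_image[of h] by (auto simp: pathfinish_def)
    ultimately show "K \<in> connected_component_set ?W ` (U \<inter> p -` {a})" by blast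
  qed
  then show ?thesis using fin a e(2) by (meson finite_imageI finite_subset subsetD)
qed simp

lemma polygon_nth: "p \<in> polygon C \<Longrightarrow> p $ Inr C = 0"
  by (auto simp: polygon_def edge_segment_eq intro!: realisation_nth_zero)

text \<open>Inside a filled polygon, the polygon is exactly the locus where the apex coordinate vanishes. So an open
disk is star-shaped about its apex.\<close>

lemma filled_polygon_boundary:
  assumes "p \<in> filled_polygon C" "p $ Inr C = 0" "{} \<notin> C"
  shows "p \<in> polygon C"
proof -
  obtain e where e: "e \<in> C" "p \<in> convex hull (insert (pt (Inr C)) (pt ` Inl ` e))"
    using assms(1) by (auto simp: filled_polygon_eq)
  then have "e \<noteq> {}" using assms(3) by blast
  then obtain u v b where b: "b \<in> realisation (Inl ` e)" and uv: "u + v = 1"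
    and p: "p = u *\<^sub>R pt (Inr C) + v *\<^sub>R b"
    using e(2) by (auto simp: convex_hull_insert)
  have "b $ Inr C = 0" using b by (rule realisation_nth_zero) auto
  then have "u = 0" using assms(2) p by (simp add: pt_nth)
  then have "p = b" using p uv by simp
  then show ?thesis using b e(1) by (auto simp: polygon_def edge_segment_eq)
qed

lemma open_cell_path_connected:
  assumes "e \<in> open_cells w"
  shows "path_connected e"
proof -
  consider v where "e = {vertex_point v}"
    | d where "d \<in> graph_edges w" "e = edge_segment d - vertex_point ` d"
    | C where "C \<in> short_cycles w" "e = filled_polygon C - polygon C"
    using assms unfolding open_cells_def by blast
  then show ?thesis
  proof cases
    case (2 d)
    then obtain x y where "d = {x, y}" by (auto simp: graph_edges_def)
    then have "e = open_segment (vertex_point x) (vertex_point y)"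
      using 2 by (simp add: edge_segment_def open_segment_def segment_convex_hull)
    then show ?thesis by (simp add: convex_imp_path_connected)
  next
    case (3 C)
    have "{} \<notin> C" using short_cycle_edges[OF 3(1)] by (auto simp: graph_edges_def)
    have "p \<in> polygon C \<longleftrightarrow> \<not> p $ Inr C > 0" if p: "p \<in> filled_polygon C" for p
    proof -
      have "p $ Inr C \<ge> 0"
        using p realisation_nth_nonneg[of p _ "Inr C"] unfolding filled_polygon_eq by blast
      then show ?thesis
        using polygon_nth[of p C] filled_polygon_boundary[OF p _ \<open>{} \<notin> C\<close>] by fastforce
    qed
    then have pos: "e = filled_polygon C \<inter> {p. p $ Inr C > 0}" using 3(2) by blast
    show ?thesis
    proof (cases "e = {}")
      case False
      then have "starlike e"
        unfolding starlike_def
      proof (intro bexI ballI)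
        fix p assume "p \<in> e"
        then have p: "p \<in> filled_polygon C" "p $ Inr C > 0" using pos by auto
        have "closed_segment (apex_point C) p \<subseteq> {p. p $ Inr C > 0}"
          using p by (intro closed_segment_subset convex_coord) (auto simp: apex_point_eq pt_nth)
        then show "closed_segment (apex_point C) p \<subseteq> e"
          using filled_polygon_segment[OF p(1)] pos by blast
      next
        obtain p where "p \<in> filled_polygon C" using False 3(2) by blast
        then have "apex_point C \<in> filled_polygon C" using filled_polygon_segment by blast
        then show "apex_point C \<in> e" unfolding pos by (simp add: apex_point_eq pt_nth)
      qed
      then show ?thesis by (rule starlike_imp_path_connected)
    qed simp
  qed simp
qed

theorem theorem6p1:
  fixes w :: "'v::finite \<Rightarrow> 'v \<Rightarrow> real" and m :: "'v \<Rightarrow> real"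
  assumes "mwg w m"
    and "spectrally_positive w m"
  shows "(\<forall>a \<in> graph_complex w. finite (carrier (fundamental_group (graph_complex w) a)))
       \<and> (\<forall>(U :: 'c::real_normed_vector set) p. universal_cover U p (graph_complex w)
            \<longrightarrow> finite (lifted_cells U p (open_cells w)))"
proof (intro conjI allI impI ballI)
  show *: "finite (carrier (fundamental_group (graph_complex w) a))" if "a \<in> graph_complex w" for a
    using finite_fundamental_group[OF assms that] .
  fix U :: "'c set" and p
  assume "universal_cover U p (graph_complex w)"
  then have cov: "covering_space U p (graph_complex w)" and U: "path_connected U"
    by (auto simp: universal_cover_def simply_connected_imp_path_connected)
  have "finite (open_cells w)" by (simp add: open_cells_def)
  moreover have "finite (components (U \<inter> p -` e))" if "e \<in> open_cells w" for e
  proof (rule finite_components_over_cell[OF cov open_cell_path_connected[OF that]])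
    show "e \<subseteq> graph_complex w" using that by (auto simp: graph_complex_def)
    show "finite (U \<inter> p -` {a})" if "a \<in> graph_complex w" for a
      using finite_fibre[OF cov U *[OF that]] .
  qed
  ultimately show "finite (lifted_cells U p (open_cells w))"
    unfolding lifted_cells_def by blast
qed

end
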